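(* Let $G$ be a separable (more generally, $\omega$-bounded) topological group. The following conditions are equivalent. (1) $G$ is precompact. (2) Every continuous affine action of $G$ on the Holmes space $\langle\mathbb{U}\rangle$ by isometries has a fixed point.
   Context: Topological groups are assumed Hausdorff. A topological group $G$ is precompact if for every neighbourhood $V$ of the identity there is a finite $F\subseteq G$ with $FV=G$; it is $\omega$-bounded if it can be covered by countably many translates of every non-empty open subset. The Urysohn space $\mathbb{U}$ is the unique (up to isometry) complete separable metric space that contains an isometric copy of every separable metric space and is ultrahomogeneous (every isometry between finite subspaces extends to an isometry of $\mathbb{U}$ onto itself). The Holmes space $\langle\mathbb{U}\rangle$ is the (unique up to linear isometry, by a theorem of Holmes) Banach space obtained as the closed linear span of the image of an isometric embedding of $\mathbb{U}$ into a real Banach space whose range contains $0$. It coincides with the Lipschitz-free Banach space $B(\mathbb{U},\ast)$: the completion of the real vector space $L(\mathbb U,\ast)$ having $\mathbb{U}\setminus\{\ast\}$ as Hamel basis and $\ast$ as zero, with the largest seminorm $p$ satisfying $p(x-y)\le d(x,y)$ for all $x,y\in\mathbb{U}$ (which is a norm). Actions by isometries are by surjective isometries; an action of $G$ on $E$ is continuous if $G\times E\to E$ is jointly continuous. *)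

theory Defs
  imports "HOL-Analysis.Analysis"
begin

section \<open>Topological groups\<close>

text \<open>
  A topological group is a type of class \<open>{topological_group_add, t2_space}\<close>. The group is written
  additively as in the library, but it need not be commutative (\<open>group_add\<close> does not assume this).
  The product \<open>FV\<close> of two subsets is their elementwise sum \<open>F + V\<close>, and a countable union of left
  translates of \<open>V\<close> is \<open>F + V\<close> for a countable \<open>F\<close>. Using right translates instead gives the same
  notions, since inversion is a homeomorphism.
\<close>

definition precompact_group :: "'g::{topological_group_add, t2_space} itself \<Rightarrow> bool" where
  "precompact_group _ \<longleftrightarrow>
     (\<forall>V :: 'g set. 0 \<in> interior V \<longrightarrow> (\<exists>F. finite F \<and> F + V = UNIV))"

definition omega_bounded_group :: "'g::{topological_group_add, t2_space} itself \<Rightarrow> bool" where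
  "omega_bounded_group _ \<longleftrightarrow>
     (\<forall>V :: 'g set. open V \<and> V \<noteq> {} \<longrightarrow> (\<exists>F. countable F \<and> F + V = UNIV))"

section \<open>The Urysohn space\<close>

definition isometric_embedding :: "'a metric \<Rightarrow> 'b metric \<Rightarrow> ('a \<Rightarrow> 'b) \<Rightarrow> bool" where
  "isometric_embedding X Y f \<longleftrightarrow>
     f ` mspace X \<subseteq> mspace Y \<and>
     (\<forall>x \<in> mspace X. \<forall>y \<in> mspace X. mdist Y (f x) (f y) = mdist X x y)"

definition surjective_isometry :: "'a metric \<Rightarrow> 'b metric \<Rightarrow> ('a \<Rightarrow> 'b) \<Rightarrow> bool" where
  "surjective_isometry X Y f \<longleftrightarrow> isometric_embedding X Y f \<and> f ` mspace X = mspace Y"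

definition ultrahomogeneous :: "'u metric \<Rightarrow> bool" where
  "ultrahomogeneous U \<longleftrightarrow>
     (\<forall>A B f. finite A \<and> A \<subseteq> mspace U \<and> finite B \<and> B \<subseteq> mspace U \<and>
        surjective_isometry (submetric U A) (submetric U B) f \<longrightarrow>
        (\<exists>h. surjective_isometry U U h \<and> (\<forall>x \<in> A. h x = f x)))"

text \<open>
  A definition cannot quantify over all types. Universality is therefore stated for the separable
  metric spaces whose points are real numbers; their metrics are arbitrary. A separable metric
  space has at most continuum many points, so every one of them is isometric to one of these: see
  \<open>urysohn_space_universal\<close> below.
\<close>

definition urysohn_space :: "'u metric \<Rightarrow> bool" where
  "urysohn_space U \<longleftrightarrow>
     mcomplete_of U \<and>
     separable_space (mtopology_of U) \<and>
     (\<forall>X :: real metric. separable_space (mtopology_of X) \<longrightarrow> (\<exists>f. isometric_embedding X U f)) \<and>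
     ultrahomogeneous U"

lemma separable_metric_inj_real:
  fixes X :: "'a metric"
  assumes "separable_space (mtopology_of X)"
  shows "\<exists>j :: 'a \<Rightarrow> real. inj_on j (mspace X)"
proof -
  interpret Metric_space "mspace X" "mdist X" by (rule Metric_space_mspace_mdist)
  obtain C where C: "countable C" "C \<subseteq> mspace X" "mtopology closure_of C = mspace X"
    using assms by (auto simp: separable_space_def mtopology_of_def)
  have dense: "\<exists>c \<in> C. mdist X x c < r" if "x \<in> mspace X" "r > 0" for x r
    using C(3) that by (force simp: metric_closure_of)
  define A where
    "A = (\<lambda>x. {prod_encode (to_nat_on C c, m) | c m. c \<in> C \<and> mdist X x c < 1 / real (Suc m)})"
  have "inj_on A (mspace X)"
  proof (rule inj_onI, rule ccontr)
    fix x y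
    assume x: "x \<in> mspace X" and y: "y \<in> mspace X" and eq: "A x = A y" and "x \<noteq> y"
    then have "mdist X x y / 2 > 0"
      by (simp add: order.not_eq_order_implies_strict)
    then obtain m where m: "1 / real (Suc m) < mdist X x y / 2"
      using nat_approx_posE by blast
    obtain c where c: "c \<in> C" "mdist X x c < 1 / real (Suc m)"
      using dense[OF x, of "1 / real (Suc m)"] by auto
    then have "prod_encode (to_nat_on C c, m) \<in> A x"
      unfolding A_def by blast
    then have "prod_encode (to_nat_on C c, m) \<in> A y"
      using eq by simp
    then obtain c' where c': "c' \<in> C" "mdist X y c' < 1 / real (Suc m)"
      "to_nat_on C c = to_nat_on C c'"
      by (auto simp: A_def)
    then have "c' = c"
      using inj_on_to_nat_on[OF C(1)] c(1) by (auto dest: inj_onD)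
    moreover have "mdist X x y \<le> mdist X x c + mdist X y c"
      using triangle[of x c y] x y c(1) C(2) by (auto simp: commute)
    ultimately show False
      using c(2) c'(2) m by (smt (verit) field_sum_of_halves)
  qed
  moreover obtain h :: "nat set \<Rightarrow> real" where "inj h"
    using nat_sets_eqpoll_reals by (auto simp: eqpoll_def bij_betw_def)
  ultimately have "inj_on (h \<circ> A) (mspace X)"
    by (simp add: comp_inj_on inj_on_subset)
  then show ?thesis by blast
qed

lemma urysohn_space_universal:
  fixes U :: "'u metric" and X :: "'a metric"
  assumes U: "urysohn_space U" and X: "separable_space (mtopology_of X)"
  shows "\<exists>f. isometric_embedding X U f"
proof -
  obtain j :: "'a \<Rightarrow> real" where j: "inj_on j (mspace X)"
    using separable_metric_inj_real[OF X] by blast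
  define R where "R = j ` mspace X"
  define g where "g = inv_into (mspace X) j"
  have gj: "g (j x) = x" if "x \<in> mspace X" for x
    using j that by (simp add: g_def)
  interpret X: Metric_space "mspace X" "mdist X" by (rule Metric_space_mspace_mdist)
  interpret Y: Metric_space R "\<lambda>x y. mdist X (g x) (g y)"
    by unfold_locales (auto simp: R_def gj X.commute X.triangle)
  interpret XY: Metric_space12 "mspace X" "mdist X" R "\<lambda>x y. mdist X (g x) (g y)" ..
  define Y where "Y = metric (R, \<lambda>x y. mdist X (g x) (g y))"
  have Y: "mspace Y = R" "mdist Y = (\<lambda>x y. mdist X (g x) (g y))" "mtopology_of Y = Y.mtopology"
    by (simp_all add: Y_def)
  have "homeomorphic_map X.mtopology Y.mtopology j"
    by (rule XY.isometry_imp_homeomorphic_map) (auto simp: R_def gj)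
  then have "separable_space (mtopology_of Y)"
    using X homeomorphic_separable_space homeomorphic_map_imp_homeomorphic_space
    by (fastforce simp: Y mtopology_of_def)
  then obtain f where "isometric_embedding Y U f"
    using U by (auto simp: urysohn_space_def)
  then have "isometric_embedding X U (f \<circ> j)"
    by (auto simp: isometric_embedding_def Y R_def gj)
  then show ?thesis by blast
qed

section \<open>The Holmes space\<close>

text \<open>
  \<open>E\<close> is the closed linear span, in the ambient real Banach space \<open>'e\<close>, of the image of an isometric
  embedding \<open>i\<close> of the Urysohn space whose range contains \<open>0\<close>.
\<close>

definition holmes_space :: "'u metric \<Rightarrow> ('u \<Rightarrow> 'e::banach) \<Rightarrow> 'e set \<Rightarrow> bool" where
  "holmes_space U i E \<longleftrightarrow>
     urysohn_space U \<and> isometric_embedding U euclidean_metric i \<and> 0 \<in> i ` mspace U \<and>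
     E = closure (span (i ` mspace U))"

section \<open>Actions\<close>

text \<open>The values \<open>a g x\<close> for \<open>x\<close> outside \<open>E\<close> are irrelevant.\<close>

definition action_on :: "'e set \<Rightarrow> ('g::group_add \<Rightarrow> 'e \<Rightarrow> 'e) \<Rightarrow> bool" where
  "action_on E a \<longleftrightarrow>
     (\<forall>g. \<forall>x \<in> E. a g x \<in> E) \<and>
     (\<forall>x \<in> E. a 0 x = x) \<and>
     (\<forall>g h. \<forall>x \<in> E. a (g + h) x = a g (a h x))"

definition affine_map_on :: "'e::real_vector set \<Rightarrow> ('e \<Rightarrow> 'e) \<Rightarrow> bool" where
  "affine_map_on E f \<longleftrightarrow>
     (\<forall>x \<in> E. \<forall>y \<in> E. \<forall>u v. u + v = 1 \<longrightarrow> f (u *\<^sub>R x + v *\<^sub>R y) = u *\<^sub>R f x + v *\<^sub>R f y)"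

definition continuous_affine_isometric_action ::
    "'e::real_normed_vector set \<Rightarrow> ('g::topological_group_add \<Rightarrow> 'e \<Rightarrow> 'e) \<Rightarrow> bool" where
  "continuous_affine_isometric_action E a \<longleftrightarrow>
     action_on E a \<and>
     (\<forall>g. affine_map_on E (a g)) \<and>
     (\<forall>g. surjective_isometry (submetric euclidean_metric E) (submetric euclidean_metric E) (a g)) \<and>
     continuous_on (UNIV \<times> E) (\<lambda>(g, x). a g x)"

end

theory Submission
  imports Defs
begin

text \<open>
  If the group \<open>G\<close> is precompact, the orbit of a point is totally bounded, and a minimal invariant
  closed convex subset of its compact closed convex hull is a single point, because compact convex
  sets have normal structure.

  If \<open>G\<close> is not precompact, there is a continuous left-invariant pseudometric on \<open>G\<close> for which finitely
  many left translates of some ball do not cover \<open>G\<close>; it is separable because \<open>G\<close> is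
  \<open>\<omega>\<close>-bounded. Adding finitely supported Katetov functions again and again yields a separable
  \<open>G\<close>-space \<open>\<Omega>\<close> with the extension property, which by back-and-forth is isometric to a dense
  part of the Urysohn space. Points of \<open>\<Omega>\<close> are at least as far apart as their finite supports in \<open>G\<close>;
  together with B. H. Neumann's lemma this shows that every finite subset of \<open>\<Omega>\<close> is moved off itself
  by a fixed positive distance. Here it matters that only finitely supported Katetov functions are
  used: a constant function would be fixed by \<open>G\<close>. By Holmes' theorem the action on \<open>\<Omega>\<close> extends to
  an action on the Holmes space by affine isometries. A fixed point would be a limit of affine
  combinations that are almost invariant, but a combination of total weight one and a translate
  with support at distance \<open>d\<close> are themselves at distance at least \<open>d\<close>.
\<close>

section \<open>Invariant pseudometrics on groups\<close>

text \<open>What turns a metric action into an affine one is that in the Holmes space the norm of a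
  combination of total weight zero depends only on the distances between the points involved. Two
  combinations of weight one differ by such a combination, so moving their points is isometric.
  Since \<open>0\<close> is itself an embedded point, combinations of weight one still exhaust the
  span, and since the group may move that point, the action is not forced to fix the origin as a
  linear one is. The lower bounds both come from test functions. For two Katetov functions given by
  finite lists, evaluate both at the base point with the smallest prescribed value: there the other
  function is larger by at least the distance between the supports. For a combination and its
  translate, pair their difference with the function that is \<open>d\<close> on one set of points
  and \<open>0\<close> on the other; it is 1-Lipschitz because the two sets are \<open>d\<close>
  apart. The extension property holds exactly and not only up to an error, so the back-and-forth
  works without completing the space over the group or passing to a quotient.\<close>

lemma sum_list_minus_rev:
  fixes xs :: "'a::group_add list"
  shows "sum_list (rev (map uminus xs)) = - sum_list xs"
  by (induction xs) (simp_all add: minus_add)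

text \<open>Frink's argument: cut the chain at the first entry where the prefix weights reach half
  of the total \<open>S\<close>. The pieces before and after that entry weigh at most
  \<open>S / 2\<close> each, so by induction their sums have weight at most \<open>S\<close>, as has
  the entry itself; \<open>triple\<close> then restores the factor 2.\<close>

lemma chain_weight_bound:
  fixes w :: "'g::monoid_add \<Rightarrow> real"
  assumes nonneg: "\<And>x. w x \<ge> 0" and zero: "w 0 = 0"
    and triple: "\<And>x y z. w (x + y + z) \<le> 2 * max (w x) (max (w y) (w z))"
  shows "w (sum_list xs) \<le> 2 * sum_list (map w xs)"
proof (induction xs rule: length_induct)
  case (1 xs)
  show ?case
  proof (cases "xs = []")
    case True
    then show ?thesis by (simp add: zero)
  next
    case False
    define s where "s = (\<lambda>k. sum_list (map w (take k xs)))"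
    define S where "S = sum_list (map w xs)"
    have S0: "S \<ge> 0"
      unfolding S_def by (rule sum_list_nonneg) (auto simp: nonneg)
    have ex: "S / 2 \<le> s (Suc (length xs - 1))"
      using False S0 by (simp add: s_def S_def)
    define k where "k = (LEAST k. S / 2 \<le> s (Suc k))"
    have k1: "S / 2 \<le> s (Suc k)"
      unfolding k_def by (rule LeastI[of "\<lambda>k. S / 2 \<le> s (Suc k)"], rule ex)
    have "k \<le> length xs - 1"
      unfolding k_def by (rule Least_le, rule ex)
    then have kl: "k < length xs"
      using False by (cases xs) auto
    have k0: "s k \<le> S / 2"
    proof (cases k)
      case 0
      then show ?thesis using S0 by (simp add: s_def)
    next
      case (Suc j)
      then show ?thesis
        using not_less_Least[of j "\<lambda>k. S / 2 \<le> s (Suc k)"] unfolding k_def[symmetric]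
        by simp
    qed
    have split: "xs = take k xs @ xs ! k # drop (Suc k) xs"
      using kl by (rule id_take_nth_drop)
    have Ssplit: "S = s k + w (xs ! k) + sum_list (map w (drop (Suc k) xs))"
      unfolding S_def s_def by (subst split) simp
    have sSuc: "s (Suc k) = s k + w (xs ! k)"
      using kl by (simp add: s_def take_Suc_conv_app_nth)
    have d: "sum_list (map w (drop (Suc k) xs)) \<le> S / 2"
      using Ssplit sSuc k1 by linarith
    have d0: "sum_list (map w (drop (Suc k) xs)) \<ge> 0"
      by (rule sum_list_nonneg) (auto simp: nonneg)
    have s0: "s k \<ge> 0"
      unfolding s_def by (rule sum_list_nonneg) (auto simp: nonneg)
    have a: "w (sum_list (take k xs)) \<le> S"
      using 1 kl k0 by (fastforce simp: s_def dest: spec[of _ "take k xs"])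
    have b: "w (sum_list (drop (Suc k) xs)) \<le> S"
      using 1 kl d by (fastforce dest: spec[of _ "drop (Suc k) xs"])
    have c: "w (xs ! k) \<le> S"
      using Ssplit s0 d0 by linarith
    have "sum_list xs = sum_list (take k xs) + xs ! k + sum_list (drop (Suc k) xs)"
      by (subst split) (simp add: add.assoc)
    then have "w (sum_list xs) \<le>
        2 * max (w (sum_list (take k xs))) (max (w (xs ! k)) (w (sum_list (drop (Suc k) xs))))"
      using triple by simp
    also have "\<dots> \<le> 2 * S"
      using a b c by simp
    finally show ?thesis by (simp add: S_def)
  qed
qed

lemma open_add_nbhd:
  fixes U :: "'g::topological_monoid_add set"
  assumes "open U" "0 \<in> U"
  obtains V where "open V" "0 \<in> V" "\<And>x y. x \<in> V \<Longrightarrow> y \<in> V \<Longrightarrow> x + y \<in> U"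
proof -
  have "open ((\<lambda>p. fst p + snd p) -` U)"
    using assms(1) by (intro open_vimage continuous_intros)
  moreover have "(0, 0) \<in> (\<lambda>p. fst p + snd p) -` U"
    using assms(2) by simp
  ultimately obtain A B where "open A" "open B" "(0, 0) \<in> A \<times> B"
      "A \<times> B \<subseteq> (\<lambda>p. fst p + snd p) -` U"
    by (rule open_prod_elim)
  then show thesis
    by (intro that[of "A \<inter> B"]) (auto simp: subset_iff)
qed

lemma open_triple_nbhd:
  fixes U :: "'g::topological_group_add set"
  assumes "open U" "0 \<in> U"
  shows "\<exists>V. (open V \<and> 0 \<in> V \<and> (\<forall>x \<in> V. - x \<in> V)) \<and>
    (\<forall>x \<in> V. \<forall>y \<in> V. \<forall>z \<in> V. x + y + z \<in> U)"
proof -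
  obtain A where A: "open A" "0 \<in> A" "\<And>x y. x \<in> A \<Longrightarrow> y \<in> A \<Longrightarrow> x + y \<in> U"
    using open_add_nbhd[OF assms] by blast
  obtain B where B: "open B" "0 \<in> B" "\<And>x y. x \<in> B \<Longrightarrow> y \<in> B \<Longrightarrow> x + y \<in> A"
    using open_add_nbhd[OF A(1,2)] by blast
  define V where "V = (A \<inter> B) \<inter> uminus -` (A \<inter> B)"
  have "open V"
    unfolding V_def using A B by (intro open_Int open_vimage continuous_intros) auto
  then show ?thesis
    using A B by (intro exI[of _ V]) (auto simp: V_def)
qed

text \<open>Birkhoff--Kakutani: a continuous left-invariant pseudometric is \<open>N (- x + y)\<close>.\<close>

locale group_seminorm =
  fixes N :: "'g::topological_group_add \<Rightarrow> real"
  assumes N_minus: "N (- x) = N x"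
    and N_add: "N (x + y) \<le> N x + N y"
    and N_zero: "N 0 = 0"
    and N_small: "e > 0 \<Longrightarrow> \<exists>A. open A \<and> 0 \<in> A \<and> (\<forall>x \<in> A. N x < e)"

text \<open>Sets \<open>V n\<close> that contain all triple sums from \<open>V (Suc n)\<close> give
  a dyadic weight \<open>w\<close>, which need not be subadditive. Its infimum \<open>N\<close> over
  chains is subadditive, and \<open>chain_weight_bound\<close> prevents it from collapsing:
  \<open>w x \<le> 2 * N x\<close>.\<close>

lemma group_seminorm_exists:
  fixes W :: "'g::topological_group_add set"
  assumes W: "open W" "0 \<in> W"
  obtains N d where "group_seminorm N" "d > 0" "\<And>x. N x < d \<Longrightarrow> x \<in> W"
proof -
  define good where "good = (\<lambda>A :: 'g set. open A \<and> 0 \<in> A \<and> (\<forall>x \<in> A. - x \<in> A))"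
  obtain V0 where V0: "good V0" "V0 \<subseteq> W"
  proof -
    have "good (W \<inter> uminus -` W)"
      using W unfolding good_def by (auto intro!: open_Int open_vimage continuous_intros)
    then show thesis using that by blast
  qed
  have "\<exists>V. \<forall>n. (good (V n) \<and> (n = 0 \<longrightarrow> V n = V0)) \<and>
      (\<forall>x \<in> V (Suc n). \<forall>y \<in> V (Suc n). \<forall>z \<in> V (Suc n). x + y + z \<in> V n)"
  proof (rule dependent_nat_choice)
    show "\<exists>A. good A \<and> (0 = (0::nat) \<longrightarrow> A = V0)" using V0 by blast
  next
    fix A and n :: nat assume "good A \<and> (n = 0 \<longrightarrow> A = V0)"
    then show "\<exists>B. (good B \<and> (Suc n = 0 \<longrightarrow> B = V0)) \<and>
        (\<forall>x\<in>B. \<forall>y\<in>B. \<forall>z\<in>B. x + y + z \<in> A)"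
      using open_triple_nbhd[of A] by (auto simp: good_def)
  qed
  then obtain V where V': "\<forall>n. (good (V n) \<and> (n = 0 \<longrightarrow> V n = V0)) \<and>
      (\<forall>x \<in> V (Suc n). \<forall>y \<in> V (Suc n). \<forall>z \<in> V (Suc n). x + y + z \<in> V n)" ..
  then have V: "\<And>n. good (V n)"
      "\<And>n x y z. x \<in> V (Suc n) \<Longrightarrow> y \<in> V (Suc n) \<Longrightarrow> z \<in> V (Suc n) \<Longrightarrow> x + y + z \<in> V n"
    by simp_all
  have "V 0 \<subseteq> W" using V' V0 by simp
  have V_0: "0 \<in> V n" for n using V(1) by (auto simp: good_def)
  have V_minus: "- x \<in> V n \<longleftrightarrow> x \<in> V n" for x n
    using V(1)[of n] by (auto simp: good_def dest: bspec[of _ _ "- x"])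
  have V_Suc: "V (Suc n) \<subseteq> V n" for n
    using V(2)[of _ n 0 0] V_0 by auto
  have V_mono: "V n \<subseteq> V m" if "m \<le> n" for m n
    by (rule lift_Suc_antimono_le[of V, OF V_Suc that])
  \<comment> \<open>The value 2 is the weight outside \<open>V 0\<close>, one dyadic step above 1,
    so that \<open>w_less\<close> also holds at \<open>n = 0\<close>.\<close>
  define w where "w = (\<lambda>x. Inf (insert 2 ((\<lambda>n. 1 / 2 ^ n) ` {n. x \<in> V n})) :: real)"
  have bdd: "bdd_below (insert 2 ((\<lambda>n. 1 / 2 ^ n :: real) ` A))" for A
    by (rule bdd_belowI[of _ 0]) auto
  have w_le2: "w x \<le> 2" for x
    unfolding w_def by (rule cInf_lower[OF _ bdd]) auto
  have w_le: "w x \<le> 1 / 2 ^ n" if "x \<in> V n" for x n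
    unfolding w_def by (rule cInf_lower[OF _ bdd]) (use that in auto)
  have w_nonneg: "w x \<ge> 0" for x
    unfolding w_def by (rule cInf_greatest) auto
  have w_less: "x \<in> V n" if "w x < 2 / 2 ^ n" for x n
  proof -
    have "\<exists>r \<in> insert 2 ((\<lambda>n. 1 / 2 ^ n) ` {n. x \<in> V n}). r < (2 / 2 ^ n :: real)"
      using that unfolding w_def by (subst (asm) cInf_less_iff[OF _ bdd]) auto
    then obtain r where r: "r \<in> insert 2 ((\<lambda>n. 1 / 2 ^ n) ` {n. x \<in> V n})" "r < (2 / 2 ^ n :: real)"
      by blast
    have "(2 / 2 ^ n :: real) \<le> 2"
      by (simp add: field_simps)
    with r obtain m where m: "x \<in> V m" "1 / 2 ^ m < (2 / 2 ^ n :: real)"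
      by auto
    then have "(2::real) ^ n < 2 ^ Suc m"
      by (simp add: field_simps)
    then have "n \<le> m"
      by (subst (asm) power_strict_increasing_iff) auto
    then show ?thesis using V_mono m(1) by blast
  qed
  have w_0: "w 0 = 0"
  proof (rule antisym[OF _ w_nonneg], rule field_le_epsilon)
    fix e :: real assume "e > 0"
    then obtain n where "(1/2::real) ^ n < e"
      using real_arch_pow_inv[of e "1/2"] by auto
    then show "w 0 \<le> 0 + e"
      using w_le[OF V_0, of n] by (simp add: power_one_over)
  qed
  have w_minus: "w (- x) = w x" for x
    by (simp add: w_def V_minus)
  have triple: "w (x + y + z) \<le> 2 * max (w x) (max (w y) (w z))" (is "?w \<le> 2 * ?M") for x y z
  proof (rule ccontr)
    assume "\<not> ?w \<le> 2 * ?M"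
    then have less: "2 * ?M < ?w" by simp
    moreover have "0 \<le> ?M" using w_nonneg[of x] by simp
    ultimately have "0 < ?w" by linarith
    then obtain n0 where "(1/2::real) ^ n0 < ?w"
      using real_arch_pow_inv[of ?w "1/2"] by auto
    then have n0: "1 / 2 ^ n0 < ?w" by (simp add: power_one_over)
    \<comment> \<open>By minimality (or \<open>w_le2\<close> if \<open>n = 0\<close>) all three
      weights lie below \<open>1 / 2 ^ n\<close>, so \<open>x\<close>, \<open>y\<close>,
      \<open>z\<close> belong to \<open>V (Suc n)\<close> and their sum to \<open>V n\<close>,
      against the choice of \<open>n\<close>.\<close>
    define n where "n = (LEAST n. 1 / 2 ^ n < ?w)"
    have n: "1 / 2 ^ n < ?w"
      unfolding n_def by (rule LeastI[of "\<lambda>n. 1 / 2 ^ n < ?w"], rule n0)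
    have M: "?M < 1 / 2 ^ n"
    proof (cases n)
      case 0
      then show ?thesis using less w_le2[of "x + y + z"] by auto
    next
      case (Suc k)
      then have "\<not> 1 / 2 ^ k < ?w"
        using not_less_Least[of k "\<lambda>n. 1 / 2 ^ n < ?w"] unfolding n_def[symmetric] by simp
      then have "2 * ?M < 1 / 2 ^ k" using less by linarith
      moreover have "1 / 2 ^ n = (1 / 2 ^ k) / (2::real)" by (simp add: Suc)
      moreover have "a < b / 2" if "2 * a < b" for a b :: real using that by simp
      ultimately show ?thesis by metis
    qed
    have "u \<in> V (Suc n)" if "w u \<le> ?M" for u
      using order.strict_trans1[OF that M] by (intro w_less) simp
    then have "x + y + z \<in> V n"
      by (intro V(2)) auto
    from w_le[OF this] n show False by simp
  qed
  have chain: "w (sum_list xs) \<le> 2 * sum_list (map w xs)" for xs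
    by (rule chain_weight_bound[OF w_nonneg w_0 triple])
  have s_nonneg: "sum_list (map w xs) \<ge> 0" for xs
    by (rule sum_list_nonneg) (auto simp: w_nonneg)
  define C where "C = (\<lambda>x. {sum_list (map w xs) | xs. sum_list xs = x})"
  define N where "N = (\<lambda>x. Inf (C x))"
  have C_ne: "C x \<noteq> {}" for x
    unfolding C_def by (auto intro: exI[of _ "[x]"])
  have C_bdd: "bdd_below (C x)" for x
    by (rule bdd_belowI[of _ 0]) (auto simp: C_def s_nonneg)
  have N_le: "N (sum_list xs) \<le> sum_list (map w xs)" for xs
    unfolding N_def by (rule cInf_lower[OF _ C_bdd]) (auto simp: C_def)
  have N_le_w: "N x \<le> w x" for x
    using N_le[of "[x]"] by simp
  have w_le_N: "w x \<le> 2 * N x" for x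
  proof -
    have "w x / 2 \<le> N x"
      unfolding N_def
    proof (rule cInf_greatest[OF C_ne])
      fix r assume "r \<in> C x"
      then obtain xs where "r = sum_list (map w xs)" "sum_list xs = x" by (auto simp: C_def)
      then show "w x / 2 \<le> r"
        using chain[of xs] by simp
    qed
    then show ?thesis by simp
  qed
  have N_minus_le: "N (- x) \<le> N x" for x
    unfolding N_def
  proof (rule cInf_greatest[OF C_ne])
    fix r assume "r \<in> C x"
    then obtain xs where xs: "r = sum_list (map w xs)" "sum_list xs = x" by (auto simp: C_def)
    have "sum_list (map w (rev (map uminus xs))) = r"
      by (simp add: xs rev_map[symmetric] comp_def w_minus)
    then show "Inf (C (- x)) \<le> r"
      using N_le[of "rev (map uminus xs)"] by (simp add: sum_list_minus_rev xs N_def)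
  qed
  have "group_seminorm N"
  proof
    show "N (- x) = N x" for x
      using N_minus_le[of x] N_minus_le[of "- x"] by simp
    show "N 0 = 0"
      using N_le_w[of 0] w_le_N[of 0] by (simp add: w_0)
    show "N (x + y) \<le> N x + N y" for x y
    proof -
      have *: "N (x + y) - s \<le> N x" if "s \<in> C y" for s
        unfolding N_def
      proof (rule cInf_greatest[OF C_ne])
        fix r assume "r \<in> C x"
        with that obtain xs ys where "r = sum_list (map w xs)" "sum_list xs = x"
            "s = sum_list (map w ys)" "sum_list ys = y"
          by (auto simp: C_def)
        then show "Inf (C (x + y)) - s \<le> r"
          using N_le[of "xs @ ys"] by (simp add: N_def)
      qed
      have "N (x + y) - N x \<le> Inf (C y)"
      proof (rule cInf_greatest[OF C_ne])
        fix s assume "s \<in> C y"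
        from *[OF this] show "N (x + y) - N x \<le> s" by simp
      qed
      then show ?thesis by (simp add: N_def)
    qed
    show "\<exists>A. open A \<and> 0 \<in> A \<and> (\<forall>x \<in> A. N x < e)" if e: "e > 0" for e
    proof -
      obtain n where "(1/2::real) ^ n < e"
        using real_arch_pow_inv[of e "1/2"] e by auto
      then have "1 / 2 ^ n < e" by (simp add: power_one_over)
      then have "\<forall>x \<in> V n. N x < e"
        using w_le N_le_w by (meson le_less_trans order_trans)
      then show ?thesis
        using V(1)[of n] by (auto simp: good_def)
    qed
  qed
  \<comment> \<open>The radius 1 yields \<open>w x < 2\<close>, the threshold for membership in
    \<open>V 0\<close>.\<close>
  moreover have "x \<in> W" if "N x < 1" for x
  proof -
    have "w x < 2 / 2 ^ 0"
      using w_le_N[of x] that by simp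
    from w_less[OF this] show ?thesis using \<open>V 0 \<subseteq> W\<close> by auto
  qed
  ultimately show thesis
    by (intro that[of N 1]) auto
qed

text \<open>B. H. Neumann's covering argument: if \<open>B j\<close> is not syndetic in this sense, some translate of
  \<open>B j\<close> misses the finitely many translates of \<open>B j\<close> in the cover, so these can be replaced by
  translates of the other sets.\<close>

lemma neumann_covering:
  fixes B :: "'i \<Rightarrow> 'g::group_add set" and Y :: "'i \<Rightarrow> 'g set"
  assumes "finite I" "\<And>i. finite (Y i)" "\<And>g. \<exists>i \<in> I. \<exists>y \<in> Y i. \<exists>b \<in> B i. g = y + b"
  shows "\<exists>i \<in> I. \<exists>F. finite F \<and> (\<forall>g. \<exists>f \<in> F. \<exists>b \<in> B i. \<exists>c \<in> B i. g = f + (b - c))"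
  using assms
proof (induction I arbitrary: Y rule: finite_induct)
  case empty
  then show ?case by blast
next
  case (insert j I)
  show ?case
  proof (cases "\<forall>g. \<exists>f \<in> Y j. \<exists>b \<in> B j. \<exists>c \<in> B j. g = f + (b - c)")
    case True
    then show ?thesis using insert.prems(1) by blast
  next
    case False
    then obtain z where z: "\<And>f b c. f \<in> Y j \<Longrightarrow> b \<in> B j \<Longrightarrow> c \<in> B j \<Longrightarrow> z \<noteq> f + (b - c)"
      by blast
    \<comment> \<open>For \<open>b\<close> in \<open>B j\<close>, the element \<open>z + b\<close>
      is in no \<open>f + B j\<close> with \<open>f\<close> in \<open>Y j\<close>, hence in some
      \<open>u + B k\<close> with \<open>k \<noteq> j\<close>; therefore \<open>y + b\<close> lies
      in \<open>y - z + u + B k\<close>.\<close>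
    define Y' where "Y' = (\<lambda>i. Y i \<union> (\<lambda>(p, q). p - z + q) ` (Y j \<times> Y i))"
    have fin: "finite (Y' i)" for i
      using insert.prems(1) by (simp add: Y'_def)
    have "\<exists>i \<in> I. \<exists>y \<in> Y' i. \<exists>b \<in> B i. g = y + b" for g
    proof -
      obtain i y b where iyb: "i \<in> insert j I" "y \<in> Y i" "b \<in> B i" "g = y + b"
        using insert.prems(2) by blast
      show ?thesis
      proof (cases "i = j")
        case False
        then show ?thesis using iyb by (auto simp: Y'_def)
      next
        case True
        obtain k u c where k: "k \<in> insert j I" "u \<in> Y k" "c \<in> B k" "z + b = u + c"
          using insert.prems(2) by blast
        have "k \<noteq> j"
        proof
          assume "k = j"
          then have "z = u + (c - b)"
            using k(4) by (metis add_diff_cancel add_diff_eq)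
          then show False using z \<open>k = j\<close> k True iyb by blast
        qed
        moreover have "g = (y - z + u) + c"
        proof -
          have "g = y - z + (z + b)"
            using iyb(4) by (simp add: add.assoc[symmetric])
          then show ?thesis by (simp add: k(4) add.assoc)
        qed
        moreover have "y - z + u \<in> Y' k"
          using iyb(2) True k(2) by (auto simp: Y'_def)
        ultimately show ?thesis using k by blast
      qed
    qed
    from insert.IH[OF fin this] show ?thesis by blast
  qed
qed

text \<open>If no \<open>g\<close> moves \<open>S\<close> off itself, then every \<open>g\<close>
  lies in some \<open>y + B x\<close>, where \<open>B x\<close> is the \<open>d\<close>-ball shifted
  on the right by \<open>- x\<close>. Neumann's lemma makes some set of differences from
  \<open>B x\<close> syndetic; in these the shifts cancel, leaving differences of two elements of
  the \<open>d\<close>-ball. This is the origin of \<open>2 * d\<close>.\<close>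

lemma (in group_seminorm) far_translate:
  assumes V: "\<And>x. N x < 2 * d \<Longrightarrow> x \<in> V" and no: "\<nexists>F. finite F \<and> F + V = UNIV" and S: "finite S"
  shows "\<exists>g. \<forall>x \<in> S. \<forall>y \<in> S. d \<le> N (- (g + x) + y)"
proof (rule ccontr)
  assume "\<not> ?thesis"
  then have *: "\<exists>x \<in> S. \<exists>y \<in> S. N (- (g + x) + y) < d" for g
    by (meson not_le)
  define B where "B = (\<lambda>x. {b - x | b. N b < d})"
  have "\<exists>x \<in> S. \<exists>y \<in> S. \<exists>b \<in> B x. g = y + b" for g
  proof -
    obtain x y where xy: "x \<in> S" "y \<in> S" "N (- (g + x) + y) < d" using * by blast
    have "N (- y + (g + x)) < d"
      using xy(3) N_minus[of "- (g + x) + y"] by (simp add: minus_add)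
    then have "- y + (g + x) - x \<in> B x" by (auto simp: B_def)
    moreover have "g = y + (- y + (g + x) - x)"
      by (simp add: add.assoc[symmetric] add_diff_eq)
    ultimately show ?thesis using xy by blast
  qed
  then obtain x F where F: "finite F" "\<And>g. \<exists>f \<in> F. \<exists>b \<in> B x. \<exists>c \<in> B x. g = f + (b - c)"
    using neumann_covering[of S "\<lambda>_. S" B] S by blast
  have "g \<in> F + V" for g
  proof -
    obtain f b c where f: "f \<in> F" "N b < d" "N c < d" "g = f + ((b - x) - (c - x))"
      using F(2)[of g] by (auto simp: B_def)
    have "N (b - c) \<le> N b + N c"
      using N_add[of b "- c"] by (simp add: N_minus)
    then have "b - c \<in> V" using V f by force
    moreover have "g = f + (b - c)"
      using f(4) by (simp add: diff_diff_eq2)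
    ultimately show ?thesis using f(1) by blast
  qed
  then show False using F(1) no by blast
qed

section \<open>The Hahn--Banach theorem for finite families\<close>

text \<open>Of a functional of norm at most one only its values \<open>t k\<close> on the family are
  recorded. The vector \<open>v\<close> to be normed enters the induction as an additional generator
  with prescribed value \<open>norm v\<close>, so that each step is the usual extension by one
  dimension.\<close>

lemma hahn_banach_family:
  fixes x :: "'k \<Rightarrow> 'e::real_normed_vector"
  assumes "finite S"
  shows "\<exists>t. (\<forall>c. (\<Sum>k\<in>S. c k * t k) \<le> norm (\<Sum>k\<in>S. c k *\<^sub>R x k)) \<and>
    (\<Sum>k\<in>S. c0 k * t k) = norm (\<Sum>k\<in>S. c0 k *\<^sub>R x k)"
proof -
  define v where "v = (\<Sum>k\<in>S. c0 k *\<^sub>R x k)"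
  have "\<exists>t. \<forall>c r. r * norm v + (\<Sum>k\<in>S. c k * t k) \<le> norm (r *\<^sub>R v + (\<Sum>k\<in>S. c k *\<^sub>R x k))"
    using assms
  proof (induction S rule: finite_induct)
    case empty
    have "r * norm v \<le> \<bar>r\<bar> * norm v" for r
      by (rule mult_right_mono) auto
    then show ?case by auto
  next
    case (insert j S)
    then obtain t where
      t: "\<And>c r. r * norm v + (\<Sum>k\<in>S. c k * t k) \<le> norm (r *\<^sub>R v + (\<Sum>k\<in>S. c k *\<^sub>R x k))"
      by blast
    define X where "X = (\<lambda>(r, c). r *\<^sub>R v + (\<Sum>k\<in>S. c k *\<^sub>R x k))"
    define T where "T = (\<lambda>(r, c). r * norm v + (\<Sum>k\<in>S. c k * t k))"
    have TX: "T p \<le> norm (X p)" for p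
      using t by (cases p) (simp add: T_def X_def)
    have lin: "\<exists>p. X p = X a + X b \<and> T p = T a + T b" for a b
      by (intro exI[of _ "(fst a + fst b, \<lambda>k. snd a k + snd b k)"])
        (auto simp: X_def T_def case_prod_beta sum.distrib algebra_simps)
    have scale: "\<exists>p. X p = s *\<^sub>R X a \<and> T p = s * T a" for s a
      by (intro exI[of _ "(s * fst a, \<lambda>k. s * snd a k)"])
        (auto simp: X_def T_def case_prod_beta scaleR_sum_right sum_distrib_left algebra_simps)
    \<comment> \<open>The value at \<open>x j\<close>: it separates the lower bounds from the upper
      bounds that the norm imposes, which are compatible by \<open>key\<close>.\<close>
    define u where "u = (SUP p. T p - norm (X p - x j))"
    have key: "T p - norm (X p - x j) \<le> norm (X q + x j) - T q" for p q
    proof -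
      obtain m where m: "X m = X p + X q" "T m = T p + T q" using lin by blast
      have "T p + T q \<le> norm ((X p - x j) + (X q + x j))"
        using TX[of m] m by simp
      also have "\<dots> \<le> norm (X p - x j) + norm (X q + x j)"
        by (rule norm_triangle_ineq)
      finally show ?thesis by simp
    qed
    have lower: "T p - norm (X p - x j) \<le> u" for p
      unfolding u_def by (rule cSUP_upper) (auto intro!: bdd_aboveI2 key)
    have upper: "u \<le> norm (X p + x j) - T p" for p
      unfolding u_def by (rule cSUP_least) (auto intro!: key)
    have main: "T p + s * u \<le> norm (X p + s *\<^sub>R x j)" for p s
    proof -
      consider "s = 0" | "s > 0" | "s < 0" by linarith
      then show ?thesis
      proof cases
        case 1
        then show ?thesis using TX by simp
      next
        case 2
        obtain q where q: "X q = (1 / s) *\<^sub>R X p" "T q = (1 / s) * T p" using scale by blast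
        have "norm (X p + s *\<^sub>R x j) = s * norm (X q + x j)"
        proof -
          have "X p + s *\<^sub>R x j = s *\<^sub>R (X q + x j)" using 2 q by (simp add: scaleR_add_right)
          then show ?thesis using 2 by simp
        qed
        moreover have "s * (u + T q) \<le> s * norm (X q + x j)"
          using upper[of q] 2 by (intro mult_left_mono) auto
        ultimately show ?thesis using 2 q by (simp add: algebra_simps)
      next
        case 3
        obtain q where q: "X q = (1 / (- s)) *\<^sub>R X p" "T q = (1 / (- s)) * T p" using scale by blast
        have "norm (X p + s *\<^sub>R x j) = (- s) * norm (X q - x j)"
        proof -
          have "X p + s *\<^sub>R x j = (- s) *\<^sub>R (X q - x j)" using 3 q by (simp add: scaleR_diff_right)
          then show ?thesis using 3 by (simp del: scaleR_minus_left)
        qed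
        moreover have "(- s) * (T q - u) \<le> (- s) * norm (X q - x j)"
          using lower[of q] 3 by (intro mult_left_mono) auto
        ultimately show ?thesis using 3 q by (simp add: algebra_simps)
      qed
    qed
    have "r * norm v + (\<Sum>k\<in>insert j S. c k * (t(j := u)) k)
        \<le> norm (r *\<^sub>R v + (\<Sum>k\<in>insert j S. c k *\<^sub>R x k))" for c r
    proof -
      have "(\<Sum>k\<in>S. c k * (t(j := u)) k) = (\<Sum>k\<in>S. c k * t k)"
        using insert.hyps by (intro sum.cong) auto
      then show ?thesis
        using insert.hyps main[of "(r, c)" "c j"]
        by (simp add: T_def X_def algebra_simps)
    qed
    then show ?case by blast
  qed
  then obtain t where
    t: "\<And>c r. r * norm v + (\<Sum>k\<in>S. c k * t k) \<le> norm (r *\<^sub>R v + (\<Sum>k\<in>S. c k *\<^sub>R x k))"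
    by blast
  have "(\<Sum>k\<in>S. c0 k * t k) = norm v"
  proof (rule antisym)
    show "(\<Sum>k\<in>S. c0 k * t k) \<le> norm v"
      using t[of 0 c0] by (simp add: v_def)
    \<comment> \<open>With \<open>r = 1\<close> and coefficients \<open>- c0\<close> the vector
      inside the norm is zero.\<close>
    show "norm v \<le> (\<Sum>k\<in>S. c0 k * t k)"
      using t[of 1 "\<lambda>k. - c0 k"] by (simp add: v_def sum_negf)
  qed
  moreover have "(\<Sum>k\<in>S. c k * t k) \<le> norm (\<Sum>k\<in>S. c k *\<^sub>R x k)" for c
    using t[of 0 c] by simp
  ultimately show ?thesis unfolding v_def by blast
qed

section \<open>Katetov extensions\<close>

text \<open>Distance zero between different points has to be allowed: \<open>N\<close> may vanish
  away from \<open>0\<close>, and different terms may describe the same point.\<close>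

locale pseudometric =
  fixes \<rho> :: "'a \<Rightarrow> 'a \<Rightarrow> real"
  assumes self [simp]: "\<rho> x x = 0"
    and sym: "\<rho> x y = \<rho> y x"
    and tri: "\<rho> x z \<le> \<rho> x y + \<rho> y z"
begin

lemma nonneg [simp]: "0 \<le> \<rho> x y"
  using tri[of x x y] by (simp add: sym)

end

text \<open>A finite Katetov function is encoded by its graph \<open>P\<close>. For a pseudometric
  the Lipschitz condition makes it single-valued, and the other condition with \<open>p = q\<close>
  makes its values nonnegative.\<close>

definition extension_property :: "('a \<Rightarrow> 'a \<Rightarrow> real) \<Rightarrow> 'a set \<Rightarrow> bool" where
  "extension_property \<rho> X \<longleftrightarrow>
     (\<forall>P. finite P \<and> fst ` P \<subseteq> X \<and>
        (\<forall>p \<in> P. \<forall>q \<in> P. \<bar>snd p - snd q\<bar> \<le> \<rho> (fst p) (fst q) \<and> \<rho> (fst p) (fst q) \<le> snd p + snd q) \<longrightarrow>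
        (\<exists>z \<in> X. \<forall>p \<in> P. \<rho> z (fst p) = snd p))"

lemma extension_propertyI:
  assumes "\<And>P. finite P \<Longrightarrow> fst ` P \<subseteq> X \<Longrightarrow>
      (\<And>p q. p \<in> P \<Longrightarrow> q \<in> P \<Longrightarrow> \<bar>snd p - snd q\<bar> \<le> \<rho> (fst p) (fst q)) \<Longrightarrow>
      (\<And>p q. p \<in> P \<Longrightarrow> q \<in> P \<Longrightarrow> \<rho> (fst p) (fst q) \<le> snd p + snd q) \<Longrightarrow>
      \<exists>z \<in> X. \<forall>p \<in> P. \<rho> z (fst p) = snd p"
  shows "extension_property \<rho> X"
  unfolding extension_property_def using assms by auto

lemma extension_propertyD:
  fixes x :: "'k \<Rightarrow> 'a"
  assumes "extension_property \<rho> X" "finite S" "\<And>k. k \<in> S \<Longrightarrow> x k \<in> X"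
    and "\<And>k l. k \<in> S \<Longrightarrow> l \<in> S \<Longrightarrow> \<bar>a k - a l\<bar> \<le> \<rho> (x k) (x l)"
    and "\<And>k l. k \<in> S \<Longrightarrow> l \<in> S \<Longrightarrow> \<rho> (x k) (x l) \<le> a k + a l"
  obtains z where "z \<in> X" "\<And>k. k \<in> S \<Longrightarrow> \<rho> z (x k) = a k"
proof -
  have "\<exists>z \<in> X. \<forall>p \<in> (\<lambda>k. (x k, a k)) ` S. \<rho> z (fst p) = snd p"
    using assms(2-) by (intro assms(1)[unfolded extension_property_def, rule_format]) auto
  then show thesis using that by auto
qed

definition katetov_corr :: "('a \<Rightarrow> 'a \<Rightarrow> real) \<Rightarrow> ('a \<times> real) list \<Rightarrow> real" where
  "katetov_corr \<rho> L =
     Max (insert 0 ((\<lambda>(p, q). (\<rho> (fst p) (fst q) - snd p - snd q) / 2) ` (set L \<times> set L)))"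

text \<open>The least additive correction makes this a Katetov function for every nonempty list; it vanishes
  if the prescribed values satisfy the Katetov conditions. In this way every list describes a
  one-point extension, and no well-formedness predicate is needed.\<close>

definition katetov :: "('a \<Rightarrow> 'a \<Rightarrow> real) \<Rightarrow> ('a \<times> real) list \<Rightarrow> 'a \<Rightarrow> real" where
  "katetov \<rho> L u = Min ((\<lambda>p. \<rho> u (fst p) + snd p) ` set L) + katetov_corr \<rho> L"

text \<open>The metric of the Katetov space: one-point extensions compared in the sup norm. The list
  \<open>[(s, 0)]\<close> is the Kuratowski image of the point \<open>s\<close>.\<close>

definition katetov_dist :: "('a \<Rightarrow> 'a \<Rightarrow> real) \<Rightarrow> ('a \<times> real) list \<Rightarrow> ('a \<times> real) list \<Rightarrow> real" where
  "katetov_dist \<rho> L M = (SUP u. \<bar>katetov \<rho> L u - katetov \<rho> M u\<bar>)"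

lemma katetov_corr_nonneg: "0 \<le> katetov_corr \<rho> L"
  unfolding katetov_corr_def by (rule Max_ge) auto

lemma katetov_corr_ge:
  assumes "p \<in> set L" "q \<in> set L"
  shows "\<rho> (fst p) (fst q) \<le> snd p + snd q + 2 * katetov_corr \<rho> L"
proof -
  have "(\<rho> (fst p) (fst q) - snd p - snd q) / 2 \<le> katetov_corr \<rho> L"
    unfolding katetov_corr_def using assms by (intro Max_ge) auto
  then show ?thesis by simp
qed

lemma katetov_corr_le:
  assumes "\<And>p q. p \<in> set L \<Longrightarrow> q \<in> set L \<Longrightarrow> \<rho> (fst p) (fst q) \<le> snd p + snd q + 2 * c" "0 \<le> c"
  shows "katetov_corr \<rho> L \<le> c"
  unfolding katetov_corr_def using assms by (intro Max.boundedI) force+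

lemma katetov_le:
  assumes "p \<in> set L"
  shows "katetov \<rho> L u \<le> \<rho> u (fst p) + snd p + katetov_corr \<rho> L"
  unfolding katetov_def using assms by simp

lemma katetov_attained:
  assumes "L \<noteq> []"
  obtains p where "p \<in> set L" "katetov \<rho> L u = \<rho> u (fst p) + snd p + katetov_corr \<rho> L"
proof -
  have "Min ((\<lambda>p. \<rho> u (fst p) + snd p) ` set L) \<in> (\<lambda>p. \<rho> u (fst p) + snd p) ` set L"
    using assms by (intro Min_in) auto
  then show thesis
    using that by (auto simp: katetov_def)
qed

lemma katetov_map:
  assumes "\<And>u v. \<rho> (f u) (f v) = \<rho> u v"
  shows "katetov \<rho> (map (map_prod f id) L) (f u) = katetov \<rho> L u"
proof -
  have "katetov_corr \<rho> (map (map_prod f id) L) = katetov_corr \<rho> L"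
  proof (rule antisym)
    show "katetov_corr \<rho> (map (map_prod f id) L) \<le> katetov_corr \<rho> L"
      using katetov_corr_ge[of _ L _ \<rho>] by (intro katetov_corr_le) (auto simp: assms katetov_corr_nonneg)
    show "katetov_corr \<rho> L \<le> katetov_corr \<rho> (map (map_prod f id) L)"
    proof (rule katetov_corr_le)
      fix p q assume "p \<in> set L" "q \<in> set L"
      then show "\<rho> (fst p) (fst q) \<le> snd p + snd q + 2 * katetov_corr \<rho> (map (map_prod f id) L)"
        using katetov_corr_ge[of "map_prod f id p" "map (map_prod f id) L" "map_prod f id q" \<rho>]
        by (auto simp: assms)
    qed (rule katetov_corr_nonneg)
  qed
  then show ?thesis by (simp add: katetov_def image_image assms)
qed

lemma katetov_dist_map:
  assumes "\<And>u v. \<rho> (f u) (f v) = \<rho> u v" "surj f"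
  shows "katetov_dist \<rho> (map (map_prod f id) L) (map (map_prod f id) M) = katetov_dist \<rho> L M"
proof -
  have "range (\<lambda>u. \<bar>katetov \<rho> (map (map_prod f id) L) u - katetov \<rho> (map (map_prod f id) M) u\<bar>)
     = (\<lambda>u. \<bar>katetov \<rho> (map (map_prod f id) L) u - katetov \<rho> (map (map_prod f id) M) u\<bar>) ` range f"
    using assms(2) by simp
  also have "\<dots> = range (\<lambda>u. \<bar>katetov \<rho> L u - katetov \<rho> M u\<bar>)"
    by (simp only: image_image katetov_map[of \<rho> f, OF assms(1)])
  finally show ?thesis by (simp add: katetov_dist_def)
qed

context pseudometric
begin

lemma katetov_lipschitz:
  assumes "L \<noteq> []"
  shows "katetov \<rho> L u \<le> katetov \<rho> L v + \<rho> u v"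
proof -
  obtain p where "p \<in> set L" "katetov \<rho> L v = \<rho> v (fst p) + snd p + katetov_corr \<rho> L"
    using assms by (rule katetov_attained)
  then show ?thesis
    using katetov_le[of p L \<rho> u] tri[of u "fst p" v] by linarith
qed

lemma katetov_triangle:
  assumes "L \<noteq> []"
  shows "\<rho> u v \<le> katetov \<rho> L u + katetov \<rho> L v"
proof -
  obtain p where p: "p \<in> set L" "katetov \<rho> L u = \<rho> u (fst p) + snd p + katetov_corr \<rho> L"
    using assms by (rule katetov_attained)
  obtain q where q: "q \<in> set L" "katetov \<rho> L v = \<rho> v (fst q) + snd q + katetov_corr \<rho> L"
    using assms by (rule katetov_attained)
  show ?thesis
    using katetov_corr_ge[OF p(1) q(1), of \<rho>] p(2) q(2)
      tri[of u v "fst p"] tri[of "fst p" v "fst q"] sym[of v "fst q"] by linarith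
qed

lemma katetov_exact:
  assumes "p \<in> set L"
    and "\<And>p q. p \<in> set L \<Longrightarrow> q \<in> set L \<Longrightarrow> \<bar>snd p - snd q\<bar> \<le> \<rho> (fst p) (fst q)"
    and "\<And>p q. p \<in> set L \<Longrightarrow> q \<in> set L \<Longrightarrow> \<rho> (fst p) (fst q) \<le> snd p + snd q"
  shows "katetov \<rho> L (fst p) = snd p"
proof -
  have "katetov_corr \<rho> L \<le> 0"
    by (rule katetov_corr_le) (use assms(3) in auto)
  then have corr: "katetov_corr \<rho> L = 0"
    using katetov_corr_nonneg[of \<rho> L] by simp
  obtain q where q: "q \<in> set L" "katetov \<rho> L (fst p) = \<rho> (fst p) (fst q) + snd q + katetov_corr \<rho> L"
    using assms(1) by (metis katetov_attained length_pos_if_in_set length_0_conv less_irrefl)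
  show ?thesis
    using q corr assms(2)[OF assms(1) q(1)] katetov_le[OF assms(1), of \<rho> "fst p"] by simp
qed

text \<open>For fixed \<open>v\<close> the bound is independent of \<open>u\<close>, so the supremum
  in \<open>katetov_dist\<close> is finite.\<close>

lemma katetov_diff_bound:
  assumes "L \<noteq> []" "M \<noteq> []"
  shows "\<bar>katetov \<rho> L u - katetov \<rho> M u\<bar> \<le> katetov \<rho> L v + katetov \<rho> M v"
  using katetov_lipschitz[OF assms(1), of u v] katetov_lipschitz[OF assms(2), of u v]
    katetov_triangle[OF assms(1), of u v] katetov_triangle[OF assms(2), of u v] by linarith

lemma katetov_dist_upper:
  assumes "L \<noteq> []" "M \<noteq> []"
  shows "\<bar>katetov \<rho> L u - katetov \<rho> M u\<bar> \<le> katetov_dist \<rho> L M"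
  unfolding katetov_dist_def
  by (rule cSUP_upper) (auto intro!: bdd_aboveI2 katetov_diff_bound assms)

lemma katetov_dist_least:
  assumes "\<And>u. \<bar>katetov \<rho> L u - katetov \<rho> M u\<bar> \<le> e"
  shows "katetov_dist \<rho> L M \<le> e"
  unfolding katetov_dist_def by (rule cSUP_least) (auto intro: assms)

lemma katetov_dist_pseudometric:
  assumes "\<And>s. e s \<noteq> []"
  shows "pseudometric (\<lambda>s t. katetov_dist \<rho> (e s) (e t))"
proof
  fix s t r
  show "katetov_dist \<rho> (e s) (e s) = 0"
    by (simp add: katetov_dist_def)
  show "katetov_dist \<rho> (e s) (e t) = katetov_dist \<rho> (e t) (e s)"
    by (simp add: katetov_dist_def abs_minus_commute)
  show "katetov_dist \<rho> (e s) (e r) \<le> katetov_dist \<rho> (e s) (e t) + katetov_dist \<rho> (e t) (e r)"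
  proof (rule katetov_dist_least)
    fix u
    show "\<bar>katetov \<rho> (e s) u - katetov \<rho> (e r) u\<bar> \<le>
        katetov_dist \<rho> (e s) (e t) + katetov_dist \<rho> (e t) (e r)"
      using katetov_dist_upper[OF assms[of s] assms[of t], of u]
        katetov_dist_upper[OF assms[of t] assms[of r], of u]
      by linarith
  qed
qed

lemma katetov_singleton: "katetov \<rho> [(s, 0)] u = \<rho> u s"
proof -
  have "katetov_corr \<rho> [(s, 0)] \<le> 0"
    by (rule katetov_corr_le) auto
  then show ?thesis
    using katetov_corr_nonneg[of \<rho> "[(s, 0)]"] by (simp add: katetov_def)
qed

lemma katetov_dist_singleton:
  assumes "L \<noteq> []"
  shows "katetov_dist \<rho> L [(s, 0)] = katetov \<rho> L s"
proof (rule antisym)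
  show "katetov_dist \<rho> L [(s, 0)] \<le> katetov \<rho> L s"
  proof (rule katetov_dist_least)
    fix u
    show "\<bar>katetov \<rho> L u - katetov \<rho> [(s, 0)] u\<bar> \<le> katetov \<rho> L s"
      using katetov_lipschitz[OF assms, of u s] katetov_triangle[OF assms, of u s]
      by (simp add: katetov_singleton)
  qed
  show "katetov \<rho> L s \<le> katetov_dist \<rho> L [(s, 0)]"
    using katetov_dist_upper[OF assms, of "[(s, 0)]" s] by (simp add: katetov_singleton)
qed

text \<open>The minimum changes by at most \<open>2 * e\<close>, once for the moved point and once
  for the changed value. The correction also changes by at most \<open>2 * e\<close>: it is half of
  an expression in which two points and two values move by \<open>e\<close> each.\<close>

lemma katetov_perturb_le:
  assumes "L \<noteq> []" "list_all2 (\<lambda>p q. \<rho> (fst p) (fst q) \<le> e \<and> \<bar>snd p - snd q\<bar> \<le> e) L M"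
  shows "katetov \<rho> M u \<le> katetov \<rho> L u + 4 * e"
proof -
  let ?R = "\<lambda>p q. \<rho> (fst p) (fst q) \<le> e \<and> \<bar>snd p - snd q\<bar> \<le> e"
  have e: "0 \<le> e"
    using assms nonneg by (cases L; cases M) (auto intro: order_trans[OF nonneg])
  have right: "\<exists>p \<in> set L. ?R p q" if "q \<in> set M" for q
    using assms(2) that by (metis (no_types, lifting) in_set_conv_nth list_all2_conv_all_nth)
  have left: "\<exists>q \<in> set M. ?R p q" if "p \<in> set L" for p
    using assms(2) that by (metis (no_types, lifting) in_set_conv_nth list_all2_conv_all_nth)
  have corr: "katetov_corr \<rho> M \<le> katetov_corr \<rho> L + 2 * e"
  proof (rule katetov_corr_le)
    fix q q' assume "q \<in> set M" "q' \<in> set M"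
    then obtain p p' where p: "p \<in> set L" "p' \<in> set L"
        "\<rho> (fst p) (fst q) \<le> e" "snd p - snd q \<le> e" "\<rho> (fst p') (fst q') \<le> e" "snd p' - snd q' \<le> e"
      using right by (meson abs_le_D1)
    show "\<rho> (fst q) (fst q') \<le> snd q + snd q' + 2 * (katetov_corr \<rho> L + 2 * e)"
      using katetov_corr_ge[OF p(1,2), of \<rho>] p(3-6) tri[of "fst q" "fst q'" "fst p"]
        tri[of "fst p" "fst q'" "fst p'"] sym[of "fst q" "fst p"] by argo
  qed (use e katetov_corr_nonneg[of \<rho> L] in auto)
  obtain p where p: "p \<in> set L" "katetov \<rho> L u = \<rho> u (fst p) + snd p + katetov_corr \<rho> L"
    using assms(1) by (rule katetov_attained)
  obtain q where q: "q \<in> set M" "?R p q" using left p(1) by blast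
  show ?thesis
    using katetov_le[OF q(1), of \<rho> u] tri[of u "fst q" "fst p"] q(2) p(2) corr by linarith
qed

lemma katetov_dist_perturb:
  assumes "L \<noteq> []" "list_all2 (\<lambda>p q. \<rho> (fst p) (fst q) \<le> e \<and> \<bar>snd p - snd q\<bar> \<le> e) L M"
  shows "katetov_dist \<rho> L M \<le> 4 * e"
proof (rule katetov_dist_least)
  fix u
  have "M \<noteq> []" using assms by (cases M) auto
  moreover have "list_all2 (\<lambda>p q. \<rho> (fst p) (fst q) \<le> e \<and> \<bar>snd p - snd q\<bar> \<le> e) M L"
    using assms(2) by (auto simp: list_all2_conv_all_nth sym abs_minus_commute)
  ultimately show "\<bar>katetov \<rho> L u - katetov \<rho> M u\<bar> \<le> 4 * e"
    using katetov_perturb_le[OF assms, of u] katetov_perturb_le[of M e L u] by linarith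
qed

end

section \<open>The universal space over a group\<close>

text \<open>Finite iterations of the one-point extension over a group; the group element at a node only
  matters at the bottom level.\<close>

datatype 'g kterm = Node 'g "('g kterm \<times> real) list"

primrec label :: "'g kterm \<Rightarrow> 'g" where
  "label (Node x L) = x"

text \<open>A leaf is read as its own Kuratowski image. With this default \<open>entries\<close> is
  never empty, so that every term describes a genuine Katetov function at every level.\<close>

primrec entries :: "'g kterm \<Rightarrow> ('g kterm \<times> real) list" where
  "entries (Node x L) = (if L = [] then [(Node x [], 0)] else L)"

text \<open>The labels that \<open>level_dist N n\<close> reads depend on \<open>n\<close>;
  collecting those of all depths gives one support that serves every level.\<close>

primrec support :: "'g kterm \<Rightarrow> 'g set" where
  "support (Node x L) = insert x (\<Union>p \<in> set (map (map_prod support id) L). fst p)"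

primrec act :: "'g::plus \<Rightarrow> 'g kterm \<Rightarrow> 'g kterm" where
  "act g (Node x L) = Node (g + x) (map (map_prod (act g) id) L)"

text \<open>The copy of \<open>t\<close> one level higher. Keeping the label leaves the support
  unchanged.\<close>

definition lift :: "'g kterm \<Rightarrow> 'g kterm" where
  "lift t = Node (label t) [(t, 0)]"

lemma entries_nonempty [simp]: "entries t \<noteq> []"
  by (cases t) auto

lemma entries_lift [simp]: "entries (lift t) = [(t, 0)]"
  by (simp add: lift_def)

lemma label_act [simp]: "label (act g t) = g + label t"
  by (cases t) simp

lemma entries_act: "entries (act g t) = map (map_prod (act g) id) (entries t)"
  by (cases t) auto

lemma act_lift: "act g (lift t) = lift (act g t)"
  by (simp add: lift_def)

lemma act_lift_pow: "act g ((lift ^^ n) t) = (lift ^^ n) (act g t)"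
  by (induction n) (simp_all add: act_lift)

lemma act_add: "act (g + h) t = act g (act (h :: 'g::semigroup_add) t)"
proof (induction t)
  case (Node x L)
  then show ?case
    by (auto simp: add.assoc map_prod_def case_prod_beta)
qed

lemma act_zero [simp]: "act (0 :: 'g::monoid_add) t = t"
proof (induction t)
  case (Node x L)
  then have "map (map_prod (act 0) id) L = map id L"
    by (intro map_cong) (auto simp: map_prod_def case_prod_beta)
  then show ?case by simp
qed

lemma surj_act: "surj (act (g :: 'g::group_add))"
proof (rule surjI)
  show "act g (act (- g) t) = t" for t
    by (simp flip: act_add)
qed

lemma label_in_support: "label t \<in> support t"
  by (cases t) simp

lemma finite_support: "finite (support t)"
proof (induction t)
  case (Node x L)
  then show ?case by fastforce
qed

lemma support_entries: "p \<in> set (entries t) \<Longrightarrow> support (fst p) \<subseteq> support t"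
  by (cases t) (auto split: if_splits)

lemma support_act: "support (act g t) = (+) g ` support t"
proof (induction t)
  case (Node x L)
  have "(\<Union>p \<in> set L. support (act g (fst p))) = (\<Union>p \<in> set L. (+) g ` support (fst p))"
    by (intro SUP_cong refl Node) (auto intro: Node simp: fsts.simps)
  then show ?case
    by (simp add: image_UN map_prod_def case_prod_beta image_image)
qed


text \<open>Every term has a reading at every level: a group element at level 0, and at level
  \<open>Suc n\<close> a one-point extension of the terms read at level \<open>n\<close>. So one
  type serves for all stages of the construction.\<close>

primrec level_dist :: "('g::group_add \<Rightarrow> real) \<Rightarrow> nat \<Rightarrow> 'g kterm \<Rightarrow> 'g kterm \<Rightarrow> real" where
  "level_dist N 0 = (\<lambda>s t. N (- label s + label t))"
| "level_dist N (Suc n) = (\<lambda>s t. katetov_dist (level_dist N n) (entries s) (entries t))"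

context group_seminorm
begin

lemma pseudometric_level: "pseudometric (level_dist N n)"
proof (induction n)
  case 0
  show ?case
  proof
    fix s t r
    show "level_dist N 0 s s = 0" by (simp add: N_zero)
    show "level_dist N 0 s t = level_dist N 0 t s"
      using N_minus[of "- label s + label t"] by (simp add: minus_add)
    have "- label s + label r = (- label s + label t) + (- label t + label r)"
      by (simp add: add.assoc)
    then show "level_dist N 0 s r \<le> level_dist N 0 s t + level_dist N 0 t r"
      using N_add[of "- label s + label t" "- label t + label r"] by simp
  qed
next
  case (Suc n)
  then interpret pseudometric "level_dist N n" .
  show ?case by (simp add: katetov_dist_pseudometric)
qed

lemma level_act: "level_dist N n (act g s) (act g t) = level_dist N n s t"
proof (induction n arbitrary: s t)
  case 0
  have "- (g + x) + (g + y) = - x + y" for x y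
    by (simp only: minus_add add.assoc minus_add_cancel)
  then show ?case by simp
next
  case (Suc n)
  show ?case
    by (simp add: entries_act katetov_dist_map[of "level_dist N n" "act g", OF Suc.IH surj_act])
qed

lemma level_lift: "level_dist N (Suc n) s (lift t) = katetov (level_dist N n) (entries s) t"
proof -
  interpret pseudometric "level_dist N n" by (rule pseudometric_level)
  show ?thesis by (simp add: katetov_dist_singleton)
qed

lemma level_lift_lift: "level_dist N (Suc n) (lift s) (lift t) = level_dist N n s t"
proof -
  interpret pseudometric "level_dist N n" by (rule pseudometric_level)
  show ?thesis by (simp add: level_lift katetov_singleton sym del: level_dist.simps)
qed

lemma level_lift_pow: "level_dist N (k + n) ((lift ^^ k) s) ((lift ^^ k) t) = level_dist N n s t"
  by (induction k) (simp_all add: level_lift_lift del: level_dist.simps(2))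

text \<open>Only the finitely many entries of a term have to be moved slightly, so finitely many
  neighbourhoods are intersected. The perturbation bound \<open>4 * (e / 8)\<close> is below
  \<open>e\<close>.\<close>

lemma level_orbit_continuous:
  assumes "e > 0"
  shows "\<exists>A. open A \<and> 0 \<in> A \<and> (\<forall>g \<in> A. level_dist N n (act g t) t < e)"
  using assms
proof (induction n arbitrary: t e)
  case 0
  obtain A where A: "open A" "0 \<in> A" "\<And>x. x \<in> A \<Longrightarrow> N x < e"
    using N_small[OF 0] by blast
  define B where "B = (\<lambda>g. - (g + label t) + label t) -` A"
  have "open B" unfolding B_def using A(1) by (intro open_vimage continuous_intros)
  moreover have "0 \<in> B" using A(2) by (simp add: B_def)
  ultimately show ?case using A(3) by (intro exI[of _ B]) (auto simp: B_def)
next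
  case (Suc n)
  interpret pseudometric "level_dist N n" by (rule pseudometric_level)
  have "0 < e / 8" using Suc.prems by simp
  then have "\<forall>p :: 'g kterm \<times> real. \<exists>A. open A \<and> 0 \<in> A \<and>
      (\<forall>g \<in> A. level_dist N n (act g (fst p)) (fst p) < e / 8)"
    using Suc.IH by blast
  from choice[OF this] obtain A where A: "\<And>p :: 'g kterm \<times> real. open (A p)" "\<And>p. 0 \<in> A p"
    "\<And>p g. g \<in> A p \<Longrightarrow> level_dist N n (act g (fst p)) (fst p) < e / 8"
    by blast
  define B where "B = (\<Inter>p \<in> set (entries t). A p)"
  have "open B" unfolding B_def using A(1) by (intro open_INT) auto
  moreover have "0 \<in> B" using A(2) by (simp add: B_def)
  moreover have "level_dist N (Suc n) (act g t) t < e" if "g \<in> B" for g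
  proof -
    have "level_dist N (Suc n) (act g t) t \<le> 4 * (e / 8)"
      unfolding level_dist.simps
    proof (rule katetov_dist_perturb)
      show "list_all2 (\<lambda>p q. level_dist N n (fst p) (fst q) \<le> e / 8 \<and> \<bar>snd p - snd q\<bar> \<le> e / 8)
          (entries (act g t)) (entries t)"
      proof -
        have "level_dist N n (act g (fst p)) (fst p) \<le> e / 8" if "p \<in> set (entries t)" for p
          using A(3)[of g p] that \<open>g \<in> B\<close> by (simp add: B_def less_imp_le)
        then show ?thesis
          using Suc.prems by (simp add: entries_act list_all2_conv_all_nth)
      qed
    qed simp
    then show ?thesis using Suc.prems by simp
  qed
  ultimately show ?case by blast
qed

text \<open>Let \<open>L\<close> be the list for which the smallest value plus the correction,
  \<open>?m L\<close>, is not larger than \<open>?m M\<close>. At the point of \<open>L\<close> with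
  the smallest value the function of \<open>L\<close> is at most \<open>?m L\<close>, while that of
  \<open>M\<close> is at least \<open>d + ?m M\<close>, since all entries of \<open>M\<close> are
  \<open>d\<close> away.\<close>

lemma level_support:
  assumes "\<And>x y. x \<in> support s \<Longrightarrow> y \<in> support t \<Longrightarrow> d \<le> N (- x + y)"
  shows "d \<le> level_dist N n s t"
  using assms
proof (induction n arbitrary: s t)
  case 0
  from 0[OF label_in_support label_in_support] show ?case by simp
next
  case (Suc n)
  interpret pseudometric "level_dist N n" by (rule pseudometric_level)
  define \<rho> where "\<rho> = level_dist N n"
  let ?m = "\<lambda>L. Min (snd ` set L) + katetov_corr \<rho> L"
  have *: "d \<le> katetov_dist \<rho> L M"
    if ne: "L \<noteq> []" "M \<noteq> []" and m: "?m L \<le> ?m M"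
      and far: "\<And>p q. p \<in> set L \<Longrightarrow> q \<in> set M \<Longrightarrow> d \<le> \<rho> (fst p) (fst q)" for L M
  proof -
    have "Min (snd ` set L) \<in> snd ` set L" using ne by (intro Min_in) auto
    then obtain p where p: "p \<in> set L" "snd p = Min (snd ` set L)" by auto
    have "katetov \<rho> L (fst p) \<le> ?m L"
      using katetov_le[OF p(1), of \<rho> "fst p"] p(2) by (simp add: \<rho>_def)
    moreover obtain q where
      q: "q \<in> set M" "katetov \<rho> M (fst p) = \<rho> (fst p) (fst q) + snd q + katetov_corr \<rho> M"
      using ne(2) by (rule katetov_attained)
    moreover have "Min (snd ` set M) \<le> snd q" using q(1) by simp
    moreover have "d \<le> \<rho> (fst p) (fst q)" by (rule far[OF p(1) q(1)])
    moreover have "\<bar>katetov \<rho> L (fst p) - katetov \<rho> M (fst p)\<bar> \<le> katetov_dist \<rho> L M"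
      unfolding \<rho>_def by (rule katetov_dist_upper[OF ne])
    ultimately show ?thesis using m by linarith
  qed
  have far: "d \<le> \<rho> (fst p) (fst q)" if "p \<in> set (entries s)" "q \<in> set (entries t)" for p q
    unfolding \<rho>_def using that Suc.prems support_entries by (intro Suc.IH) blast
  have far': "d \<le> \<rho> (fst p) (fst q)" if "p \<in> set (entries t)" "q \<in> set (entries s)" for p q
    using far[OF that(2,1)] by (simp add: \<rho>_def sym)
  have "katetov_dist \<rho> (entries s) (entries t) = katetov_dist \<rho> (entries t) (entries s)"
    by (simp add: katetov_dist_def abs_minus_commute)
  moreover have "d \<le> katetov_dist \<rho> (entries s) (entries t) \<or>
      d \<le> katetov_dist \<rho> (entries t) (entries s)"
    using *[of "entries s" "entries t"] *[of "entries t" "entries s"] far far' by fastforce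
  ultimately show ?case by (simp add: \<rho>_def)
qed

lemma level_separable:
  assumes "\<And>A :: 'g set. open A \<Longrightarrow> A \<noteq> {} \<Longrightarrow> \<exists>F. countable F \<and> F + A = UNIV"
  shows "\<exists>D. countable D \<and> (\<forall>t. \<forall>e > 0. \<exists>s \<in> D. level_dist N n t s < e)"
proof (induction n)
  case 0
  have "\<exists>F. countable F \<and> (\<forall>x. \<exists>f \<in> F. N (- x + f) < 1 / real (Suc k))" for k
  proof -
    obtain A where A: "open A" "0 \<in> A" "\<And>x. x \<in> A \<Longrightarrow> N x < 1 / real (Suc k)"
      using N_small[of "1 / real (Suc k)"] by auto
    then obtain F where F: "countable F" "F + A = UNIV"
      using assms by blast
    have "\<exists>f \<in> F. N (- x + f) < 1 / real (Suc k)" for x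
    proof -
      have "x \<in> F + A" by (simp add: F)
      then obtain f a where fa: "f \<in> F" "a \<in> A" "x = f + a" by (rule set_plus_elim)
      have "N (- x + f) = N a"
        using N_minus[of a] by (simp add: fa(3) minus_add add.assoc)
      then show ?thesis using A(3)[OF fa(2)] fa(1) by metis
    qed
    then show ?thesis using F(1) by blast
  qed
  then have "\<forall>k. \<exists>F. countable F \<and> (\<forall>x. \<exists>f \<in> F. N (- x + f) < 1 / real (Suc k))" ..
  from choice[OF this] obtain F
    where F': "\<forall>k. countable (F k) \<and> (\<forall>x. \<exists>f \<in> F k. N (- x + f) < 1 / real (Suc k))" ..
  have F: "countable (F k)" "\<exists>f \<in> F k. N (- x + f) < 1 / real (Suc k)" for k x
    using F'[rule_format, of k] by (rule conjunct1, rule spec[OF conjunct2])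
  define D where "D = (\<lambda>x. Node x []) ` (\<Union>k. F k)"
  have "\<exists>s \<in> D. level_dist N 0 t s < e" if e: "e > 0" for t e
  proof -
    obtain k where k: "1 / real (Suc k) < e" using nat_approx_posE[OF e] by metis
    obtain f where f: "f \<in> F k" "N (- label t + f) < 1 / real (Suc k)" using F(2) by metis
    have "Node f [] \<in> D" using f(1) by (auto simp: D_def)
    moreover have "level_dist N 0 t (Node f []) < e" using f(2) k by simp
    ultimately show ?thesis by (rule bexI[rotated])
  qed
  moreover have "countable D" unfolding D_def using F(1) by blast
  ultimately show ?case by blast
next
  case (Suc n)
  interpret pseudometric "level_dist N n" by (rule pseudometric_level)
  obtain D where D: "countable D" "\<And>t e. e > 0 \<Longrightarrow> \<exists>s \<in> D. level_dist N n t s < e"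
    using Suc by blast
  \<comment> \<open>On nonempty lists \<open>level_dist N (Suc n)\<close> depends on the entries
    only, so the label \<open>0\<close> serves for all approximating terms.\<close>
  define D' where "D' = Node 0 ` lists (D \<times> \<rat>)"
  have "countable D'"
    unfolding D'_def using D(1) countable_rat by (intro countable_image countable_lists countable_SIGMA)
  moreover have "\<exists>s \<in> D'. level_dist N (Suc n) t s < e" if e: "e > 0" for t e
  proof -
    have "\<exists>q \<in> D \<times> \<rat>. level_dist N n (fst p) (fst q) \<le> e / 8 \<and> \<bar>snd p - snd q\<bar> \<le> e / 8" for p
    proof -
      obtain s where s: "s \<in> D" "level_dist N n (fst p) s < e / 8"
        using D(2)[of "e / 8"] e by auto
      obtain r where r: "r \<in> \<rat>" "snd p < r" "r < snd p + e / 8"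
        using Rats_dense_in_real[of "snd p" "snd p + e / 8"] e by auto
      show ?thesis using s r by (intro bexI[of _ "(s, r)"]) auto
    qed
    then obtain q where q: "\<And>p. q p \<in> D \<times> \<rat>"
      "\<And>p. level_dist N n (fst p) (fst (q p)) \<le> e / 8 \<and> \<bar>snd p - snd (q p)\<bar> \<le> e / 8"
      by metis
    define s where "s = Node 0 (map q (entries t))"
    have ents: "entries s = map q (entries t)"
      by (simp add: s_def)
    have "level_dist N (Suc n) t s \<le> 4 * (e / 8)"
      unfolding level_dist.simps
      by (rule katetov_dist_perturb, simp) (use q(2) in \<open>simp add: ents list_all2_conv_all_nth\<close>)
    moreover have "map q (entries t) \<in> lists (D \<times> \<rat>)"
      unfolding in_lists_conv_set set_map using q(1) by blast
    then have "s \<in> D'"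
      unfolding s_def D'_def by (rule imageI)
    ultimately show ?thesis using e by (intro bexI[of _ s]) auto
  qed
  ultimately show ?case by blast
qed

text \<open>The direct limit of the levels along \<open>lift\<close>.\<close>

definition limit_dist :: "nat \<times> 'g kterm \<Rightarrow> nat \<times> 'g kterm \<Rightarrow> real" where
  "limit_dist p q = level_dist N (fst p + fst q) ((lift ^^ fst q) (snd p)) ((lift ^^ fst p) (snd q))"

definition limit_act :: "'g \<Rightarrow> nat \<times> 'g kterm \<Rightarrow> nat \<times> 'g kterm" where
  "limit_act g p = (fst p, act g (snd p))"

text \<open>Lifting is isometric, so any level above both points may replace the sum of their
  levels. Finitely many points can therefore be treated at one level.\<close>

lemma limit_dist_common:
  assumes "fst p \<le> m" "fst q \<le> m"
  shows "limit_dist p q = level_dist N m ((lift ^^ (m - fst p)) (snd p)) ((lift ^^ (m - fst q)) (snd q))"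
    (is "_ = ?r")
proof -
  have "limit_dist p q = level_dist N (m + (fst p + fst q))
      ((lift ^^ m) ((lift ^^ fst q) (snd p))) ((lift ^^ m) ((lift ^^ fst p) (snd q)))"
    unfolding limit_dist_def by (rule level_lift_pow[symmetric])
  also have "\<dots> = level_dist N ((fst p + fst q) + m) ((lift ^^ (fst p + fst q)) ((lift ^^ (m - fst p)) (snd p)))
      ((lift ^^ (fst p + fst q)) ((lift ^^ (m - fst q)) (snd q)))"
    using assms by (simp add: add.commute flip: funpow_add comp_apply[of "lift ^^ _" "lift ^^ _"])
  also have "\<dots> = ?r" by (rule level_lift_pow)
  finally show ?thesis .
qed

lemma pseudometric_limit: "pseudometric limit_dist"
proof
  fix p q r :: "nat \<times> 'g kterm"
  define m where "m = fst p + fst q + fst r"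
  interpret pseudometric "level_dist N m" by (rule pseudometric_level)
  have *: "fst p \<le> m" "fst q \<le> m" "fst r \<le> m" by (simp_all add: m_def)
  show "limit_dist p p = 0" using * by (simp add: limit_dist_common)
  show "limit_dist p q = limit_dist q p" using * by (simp add: limit_dist_common sym)
  show "limit_dist p r \<le> limit_dist p q + limit_dist q r" using * by (simp add: limit_dist_common tri)
qed

lemma limit_dist_act: "limit_dist (limit_act g p) (limit_act g q) = limit_dist p q"
  by (simp add: limit_dist_def limit_act_def level_act flip: act_lift_pow)

lemma limit_act_add: "limit_act (g + h) p = limit_act g (limit_act h p)"
  by (simp add: limit_act_def act_add)

lemma limit_act_zero: "limit_act 0 p = p"
  by (simp add: limit_act_def)

lemma limit_orbit_continuous:
  assumes "e > 0"
  shows "\<exists>A. open A \<and> 0 \<in> A \<and> (\<forall>g \<in> A. limit_dist (limit_act g p) p < e)"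
  using level_orbit_continuous[OF assms, of "fst p" "snd p"]
  by (simp add: limit_dist_common[of _ "fst p"] limit_act_def)

lemma limit_separable:
  assumes "\<And>A :: 'g set. open A \<Longrightarrow> A \<noteq> {} \<Longrightarrow> \<exists>F. countable F \<and> F + A = UNIV"
  shows "\<exists>D. countable D \<and> (\<forall>p. \<forall>e > 0. \<exists>q \<in> D. limit_dist p q < e)"
proof -
  obtain D where D: "\<And>n. countable (D n)" "\<And>n t e. e > 0 \<Longrightarrow> \<exists>s \<in> D n. level_dist N n t s < e"
    using level_separable[OF assms] by metis
  define D' where "D' = (SIGMA n:UNIV. D n)"
  have "countable D'" unfolding D'_def using D(1) by (intro countable_SIGMA) auto
  moreover have "\<exists>q \<in> D'. limit_dist p q < e" if e: "e > 0" for p e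
  proof -
    obtain s where "s \<in> D (fst p)" "level_dist N (fst p) (snd p) s < e"
      using D(2)[OF e] by blast
    then show ?thesis
      by (intro bexI[of _ "(fst p, s)"]) (auto simp: D'_def limit_dist_common[of _ "fst p"])
  qed
  ultimately show ?thesis by blast
qed

text \<open>Lifted to a common level \<open>m\<close>, the prescribed values form the list of a term
  at level \<open>Suc m\<close>; the Katetov conditions make its correction vanish, so this term has
  exactly the prescribed distances.\<close>

lemma limit_extension: "extension_property limit_dist UNIV"
proof (rule extension_propertyI)
  fix P :: "((nat \<times> 'g kterm) \<times> real) set"
  assume "finite P"
    and lip: "\<And>p q. p \<in> P \<Longrightarrow> q \<in> P \<Longrightarrow> \<bar>snd p - snd q\<bar> \<le> limit_dist (fst p) (fst q)"
    and sum: "\<And>p q. p \<in> P \<Longrightarrow> q \<in> P \<Longrightarrow> limit_dist (fst p) (fst q) \<le> snd p + snd q"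
  show "\<exists>z \<in> UNIV. \<forall>p \<in> P. limit_dist z (fst p) = snd p"
  proof (cases "P = {}")
    case False
    define m where "m = (\<Sum>p\<in>P. fst (fst p))"
    have m: "fst (fst p) \<le> m" if "p \<in> P" for p
      unfolding m_def using \<open>finite P\<close> that by (intro member_le_sum) auto
    interpret pseudometric "level_dist N m" by (rule pseudometric_level)
    define u where "u = (\<lambda>p :: (nat \<times> 'g kterm) \<times> real. (lift ^^ (m - fst (fst p))) (snd (fst p)))"
    have dist: "limit_dist (fst p) (fst q) = level_dist N m (u p) (u q)" if "p \<in> P" "q \<in> P" for p q
      using m that by (simp add: limit_dist_common[of _ m] u_def)
    obtain ps where ps: "set ps = P" using \<open>finite P\<close> finite_list by blast
    define L where "L = map (\<lambda>p. (u p, snd p)) ps"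
    have L: "entries (Node 0 L) = L" using ps False by (auto simp: L_def)
    define z where "z = (Suc m, Node 0 L)"
    have "limit_dist z (fst p) = snd p" if p: "p \<in> P" for p
    proof -
      have "limit_dist z (fst p) = level_dist N (Suc m) (Node 0 L) (lift (u p))"
        using m[OF p]
        by (simp add: limit_dist_common[of _ "Suc m"] z_def u_def Suc_diff_le del: level_dist.simps)
      also have "\<dots> = katetov (level_dist N m) L (fst (u p, snd p))"
        by (simp only: level_lift L fst_conv)
      also have "\<dots> = snd (u p, snd p)"
        using p lip sum by (intro katetov_exact) (auto simp: L_def ps dist)
      finally show ?thesis by simp
    qed
    then show ?thesis by blast
  qed simp
qed

text \<open>The supports of finitely many points form a finite set, to which
  \<open>far_translate\<close> applies; \<open>level_support\<close> carries the distance
  back.\<close>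

lemma limit_far_translate:
  assumes V: "\<And>x. N x < 2 * d \<Longrightarrow> x \<in> V" and no: "\<nexists>F. finite F \<and> F + V = UNIV" and "finite P"
  shows "\<exists>g. \<forall>p \<in> P. \<forall>q \<in> P. d \<le> limit_dist (limit_act g p) q"
proof -
  have support_lift: "support ((lift ^^ n) t) = support t" for n and t :: "'g kterm"
  proof (induction n)
    case (Suc n)
    have "support (lift s) = support s" for s :: "'g kterm"
      using label_in_support[of s] by (auto simp: lift_def)
    then show ?case using Suc by simp
  qed simp
  have "finite (\<Union>p \<in> P. support (snd p))"
    using assms(3) finite_support by blast
  then obtain g where g: "\<And>x y. x \<in> (\<Union>p \<in> P. support (snd p)) \<Longrightarrow> y \<in> (\<Union>p \<in> P. support (snd p)) \<Longrightarrow>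
      d \<le> N (- (g + x) + y)"
    using far_translate[OF V no] by meson
  have "d \<le> limit_dist (limit_act g p) q" if "p \<in> P" "q \<in> P" for p q
    unfolding limit_dist_def
    by (rule level_support) (use g that in \<open>auto simp: support_lift support_act limit_act_def\<close>)
  then show ?thesis by blast
qed

end

section \<open>Back-and-forth with the Urysohn space\<close>

text \<open>The converse of such a relation need not be single-valued, since \<open>\<rho>\<close>
  may be zero between different points.\<close>

definition isometric_relation :: "('a \<Rightarrow> 'a \<Rightarrow> real) \<Rightarrow> ('a \<times> 'e::metric_space) set \<Rightarrow> bool" where
  "isometric_relation \<rho> R \<longleftrightarrow> (\<forall>p \<in> R. \<forall>q \<in> R. dist (snd p) (snd q) = \<rho> (fst p) (fst q))"

text \<open>Partners of points converging to \<open>x\<close> form a Cauchy sequence, whose limit is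
  \<open>J x\<close>. This serves twice: to embed the space over the group, and later, with
  \<open>dist\<close> as \<open>\<rho>\<close>, to extend each group element from combinations to
  their closure.\<close>

lemma (in pseudometric) isometric_relation_extend:
  fixes R :: "('a \<times> 'e::complete_space) set"
  assumes R: "isometric_relation \<rho> R"
    and dense: "\<And>x e. x \<in> X \<Longrightarrow> e > 0 \<Longrightarrow> \<exists>p \<in> R. \<rho> x (fst p) < e"
  obtains J where "\<And>x y. x \<in> X \<Longrightarrow> y \<in> X \<Longrightarrow> dist (J x) (J y) = \<rho> x y"
    "\<And>x p. x \<in> X \<Longrightarrow> p \<in> R \<Longrightarrow> dist (J x) (snd p) = \<rho> x (fst p)"
    "\<And>x. x \<in> X \<Longrightarrow> J x \<in> closure (snd ` R)"
proof -
  have R': "dist (snd p) (snd q) = \<rho> (fst p) (fst q)" if "p \<in> R" "q \<in> R" for p q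
    using R that by (auto simp: isometric_relation_def)
  have "\<exists>y. (\<forall>p \<in> R. dist y (snd p) = \<rho> x (fst p)) \<and> y \<in> closure (snd ` R)" if x: "x \<in> X" for x
  proof -
    have "\<exists>p \<in> R. \<rho> x (fst p) < 1 / real (Suc n)" for n
      by (rule dense[OF x]) simp
    then obtain p where p: "\<And>n. p n \<in> R" "\<And>n. \<rho> x (fst (p n)) < 1 / real (Suc n)"
      by metis
    have to0: "(\<lambda>n. \<rho> x (fst (p n))) \<longlonglongrightarrow> 0"
    proof (rule tendsto_sandwich[of "\<lambda>_. 0"])
      show "(\<lambda>n. 1 / real (Suc n)) \<longlonglongrightarrow> 0"
        using LIMSEQ_inverse_real_of_nat by (simp add: inverse_eq_divide)
    qed (use p(2) in \<open>auto intro!: always_eventually intro: less_imp_le\<close>)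
    have "Cauchy (\<lambda>n. snd (p n))"
    proof (rule metric_CauchyI)
      fix e :: real assume "e > 0"
      then obtain M where M: "\<And>n. n \<ge> M \<Longrightarrow> \<rho> x (fst (p n)) < e / 2"
        using order_tendstoD(2)[OF to0, of "e / 2"] by (auto simp: eventually_sequentially)
      have "dist (snd (p m)) (snd (p n)) < e" if "m \<ge> M" "n \<ge> M" for m n
        using R'[OF p(1) p(1), of m n] M[OF that(1)] M[OF that(2)]
          tri[of "fst (p m)" "fst (p n)" x] sym[of "fst (p m)" x] by linarith
      then show "\<exists>M. \<forall>m\<ge>M. \<forall>n\<ge>M. dist (snd (p m)) (snd (p n)) < e" by blast
    qed
    then obtain y where y: "(\<lambda>n. snd (p n)) \<longlonglongrightarrow> y"
      using Cauchy_convergent unfolding convergent_def by blast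
    have "dist y (snd q) = \<rho> x (fst q)" if q: "q \<in> R" for q
    proof -
      have "(\<lambda>n. \<rho> (fst (p n)) (fst q)) \<longlonglongrightarrow> dist y (snd q)"
        using tendsto_dist[OF y tendsto_const, of "snd q"] by (simp add: R' p(1) q)
      moreover have "(\<lambda>n. \<rho> (fst (p n)) (fst q)) \<longlonglongrightarrow> \<rho> x (fst q)"
      proof (rule LIM_zero_cancel, rule Lim_null_comparison[OF _ to0])
        have "\<bar>\<rho> (fst (p n)) (fst q) - \<rho> x (fst q)\<bar> \<le> \<rho> x (fst (p n))" for n
          using tri[of "fst (p n)" "fst q" x] tri[of x "fst q" "fst (p n)"] sym[of x "fst (p n)"]
          by linarith
        then show "\<forall>\<^sub>F n in sequentially. norm (\<rho> (fst (p n)) (fst q) - \<rho> x (fst q)) \<le> \<rho> x (fst (p n))"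
          by simp
      qed
      ultimately show ?thesis by (rule LIMSEQ_unique)
    qed
    moreover have "y \<in> closure (snd ` R)"
      unfolding closure_sequential using y p(1) by (intro exI[of _ "\<lambda>n. snd (p n)"]) auto
    ultimately show ?thesis by blast
  qed
  then have "\<forall>x \<in> X. \<exists>y. (\<forall>p \<in> R. dist y (snd p) = \<rho> x (fst p)) \<and> y \<in> closure (snd ` R)" ..
  from bchoice[OF this] obtain J where
    J': "\<forall>x \<in> X. (\<forall>p \<in> R. dist (J x) (snd p) = \<rho> x (fst p)) \<and> J x \<in> closure (snd ` R)" ..
  then have J: "dist (J x) (snd p) = \<rho> x (fst p)" if "x \<in> X" "p \<in> R" for x p
    using that by blast
  have "dist (J x) (J y) = \<rho> x y" if xy: "x \<in> X" "y \<in> X" for x y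
  proof -
    have "\<bar>dist (J x) (J y) - \<rho> x y\<bar> \<le> e" if e: "e > 0" for e
    proof -
      obtain p where p: "p \<in> R" "\<rho> y (fst p) < e / 2"
        using dense[OF xy(2), of "e / 2"] e by auto
      have "\<bar>dist (J x) (J y) - dist (J x) (snd p)\<bar> \<le> dist (J y) (snd p)"
        by metric
      moreover have "\<bar>\<rho> x y - \<rho> x (fst p)\<bar> \<le> \<rho> y (fst p)"
        using tri[of x y "fst p"] tri[of x "fst p" y] sym[of y "fst p"] by linarith
      ultimately show ?thesis using p J[OF xy(1) p(1)] J[OF xy(2) p(1)] by linarith
    qed
    then have "\<bar>dist (J x) (J y) - \<rho> x y\<bar> \<le> 0"
      using field_le_epsilon[of "\<bar>dist (J x) (J y) - \<rho> x y\<bar>" 0] by simp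
    then show ?thesis by simp
  qed
  then show thesis
    using J J' that by blast
qed

text \<open>As the extension property is exact on both sides, a finite isometric relation accepts
  any further point of \<open>'a\<close> or of \<open>D\<close>. Each stage adds one point from the
  enumeration of \<open>A\<close> and one from that of \<open>B\<close>.\<close>

lemma (in pseudometric) back_and_forth:
  fixes D :: "'e::metric_space set"
  assumes ext: "extension_property \<rho> UNIV" and extD: "extension_property dist D"
    and A: "countable A" and B: "countable B" "B \<subseteq> D" "B \<noteq> {}"
  obtains R where "isometric_relation \<rho> R" "A \<subseteq> fst ` R" "B \<subseteq> snd ` R" "snd ` R \<subseteq> D"
proof -
  define good where "good = (\<lambda>R :: ('a \<times> 'e) set. finite R \<and> snd ` R \<subseteq> D \<and> isometric_relation \<rho> R)"
  have right: "\<exists>y. good (insert (x, y) R)" if R: "good R" for x R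
  proof -
    have iso: "dist (snd p) (snd q) = \<rho> (fst p) (fst q)" if "p \<in> R" "q \<in> R" for p q
      using R that by (auto simp: good_def isometric_relation_def)
    obtain y where y: "y \<in> D" "\<And>p. p \<in> R \<Longrightarrow> dist y (snd p) = \<rho> x (fst p)"
    proof (rule extension_propertyD[OF extD, of R snd "\<lambda>p. \<rho> x (fst p)"])
      fix p q assume pq: "p \<in> R" "q \<in> R"
      show "\<bar>\<rho> x (fst p) - \<rho> x (fst q)\<bar> \<le> dist (snd p) (snd q)"
        using iso[OF pq] tri[of x "fst p" "fst q"] tri[of x "fst q" "fst p"]
          sym[of "fst p" "fst q"] by linarith
      show "dist (snd p) (snd q) \<le> \<rho> x (fst p) + \<rho> x (fst q)"
        using iso[OF pq] tri[of "fst p" "fst q" x] sym[of "fst p" x] by linarith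
    qed (use R in \<open>auto simp: good_def\<close>)
    then have "good (insert (x, y) R)"
      using R by (auto simp: good_def isometric_relation_def dist_commute sym)
    then show ?thesis by blast
  qed
  have left: "\<exists>x. good (insert (x, y) R)" if R: "good R" and "y \<in> D" for y R
  proof -
    have iso: "dist (snd p) (snd q) = \<rho> (fst p) (fst q)" if "p \<in> R" "q \<in> R" for p q
      using R that by (auto simp: good_def isometric_relation_def)
    obtain x where x: "\<And>p. p \<in> R \<Longrightarrow> \<rho> x (fst p) = dist y (snd p)"
    proof (rule extension_propertyD[OF ext, of R fst "\<lambda>p. dist y (snd p)"])
      fix p q assume pq: "p \<in> R" "q \<in> R"
      show "\<bar>dist y (snd p) - dist y (snd q)\<bar> \<le> \<rho> (fst p) (fst q)"
        unfolding iso[OF pq, symmetric] by metric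
      show "\<rho> (fst p) (fst q) \<le> dist y (snd p) + dist y (snd q)"
        unfolding iso[OF pq, symmetric] by metric
    qed (use R in \<open>auto simp: good_def\<close>)
    then have "good (insert (x, y) R)"
      using R \<open>y \<in> D\<close> by (auto simp: good_def isometric_relation_def dist_commute sym)
    then show ?thesis by blast
  qed
  obtain a :: "nat \<Rightarrow> 'a" where a: "A \<subseteq> range a"
    using A by (metis countable_subset_image empty_subsetI from_nat_into_surj subsetI rangeI)
  have b: "range (from_nat_into B) = B"
    using B by (simp add: range_from_nat_into)
  have "\<exists>f. \<forall>n. good (f n) \<and> (f n \<subseteq> f (Suc n) \<and> a n \<in> fst ` f (Suc n) \<and> from_nat_into B n \<in> snd ` f (Suc n))"
  proof (rule dependent_nat_choice)
    show "\<exists>R. good R"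
      by (intro exI[of _ "{}"]) (simp add: good_def isometric_relation_def)
    fix R and n :: nat assume R: "good R"
    obtain y where "good (insert (a n, y) R)" using right[OF R] by blast
    moreover have "from_nat_into B n \<in> D" using b B(2) by blast
    ultimately obtain x where "good (insert (x, from_nat_into B n) (insert (a n, y) R))"
      using left by blast
    then show "\<exists>R'. good R' \<and> R \<subseteq> R' \<and> a n \<in> fst ` R' \<and> from_nat_into B n \<in> snd ` R'"
      by (intro exI[of _ "insert (x, from_nat_into B n) (insert (a n, y) R)"]) auto
  qed
  then obtain f where f: "\<And>n. good (f n)" "\<And>n. f n \<subseteq> f (Suc n)"
    "\<And>n. a n \<in> fst ` f (Suc n)" "\<And>n. from_nat_into B n \<in> snd ` f (Suc n)"
    by blast
  have mono: "f m \<subseteq> f n" if "m \<le> n" for m n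
    by (rule lift_Suc_mono_le[of f, OF f(2) that])
  show thesis
  proof (rule that[of "\<Union>n. f n"])
    show "isometric_relation \<rho> (\<Union>n. f n)"
      unfolding isometric_relation_def
    proof (intro ballI)
      fix p q assume "p \<in> (\<Union>n. f n)" "q \<in> (\<Union>n. f n)"
      then obtain m n where "p \<in> f m" "q \<in> f n" by blast
      then have "p \<in> f (max m n)" "q \<in> f (max m n)"
        using mono[of m "max m n"] mono[of n "max m n"] by auto
      then show "dist (snd p) (snd q) = \<rho> (fst p) (fst q)"
        using f(1)[of "max m n"] by (auto simp: good_def isometric_relation_def)
    qed
    have "range a \<subseteq> (\<Union>n. fst ` f n)"
      using f(3) by (intro image_subsetI UN_I[OF UNIV_I])
    moreover have "range (from_nat_into B) \<subseteq> (\<Union>n. snd ` f n)"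
      using f(4) by (intro image_subsetI UN_I[OF UNIV_I])
    ultimately show "A \<subseteq> fst ` (\<Union>n. f n)" "B \<subseteq> snd ` (\<Union>n. f n)"
      using a by (simp_all add: b image_UN)
    show "snd ` (\<Union>n. f n) \<subseteq> D"
      using f(1) by (auto simp: good_def)
  qed
qed

text \<open>Adjoin an abstract point \<open>None\<close> with the prescribed distances, embed the
  finite space so obtained by universality, and move the copy of \<open>A\<close> back to
  \<open>A\<close> by ultrahomogeneity. The image of \<open>None\<close> is the required
  point.\<close>

lemma urysohn_extension_property:
  assumes U: "urysohn_space U" and i: "isometric_embedding U euclidean_metric i"
  shows "extension_property dist (i ` mspace U)"
proof (rule extension_propertyI)
  fix P :: "('b \<times> real) set"
  assume P: "finite P" "fst ` P \<subseteq> i ` mspace U"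
    and lip: "\<And>p q. p \<in> P \<Longrightarrow> q \<in> P \<Longrightarrow> \<bar>snd p - snd q\<bar> \<le> dist (fst p) (fst q)"
    and sum: "\<And>p q. p \<in> P \<Longrightarrow> q \<in> P \<Longrightarrow> dist (fst p) (fst q) \<le> snd p + snd q"
  have i_dist: "dist (i u) (i v) = mdist U u v" if "u \<in> mspace U" "v \<in> mspace U" for u v
    using i that by (auto simp: isometric_embedding_def)
  show "\<exists>z \<in> i ` mspace U. \<forall>p \<in> P. dist z (fst p) = snd p"
  \<comment> \<open>If some prescribed value is 0, its base point is the solution. Otherwise all
    values are positive, and adjoining a point gives a metric rather than a pseudometric.\<close>
  proof (cases "\<exists>p \<in> P. snd p = 0")
    case True
    then obtain p where p: "p \<in> P" "snd p = 0" by blast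
    have "dist (fst p) (fst q) = snd q" if "q \<in> P" for q
      using lip[OF p(1) that] sum[OF p(1) that] p(2) by linarith
    then show ?thesis using p P(2) by blast
  next
    case False
    have pos: "snd p > 0" if "p \<in> P" for p
      using sum[OF that that] False that by fastforce
    have "\<forall>p \<in> P. \<exists>u. u \<in> mspace U \<and> i u = fst p"
      using P(2) by fastforce
    from bchoice[OF this] obtain j where j: "\<And>p. p \<in> P \<Longrightarrow> j p \<in> mspace U" "\<And>p. p \<in> P \<Longrightarrow> i (j p) = fst p"
      by blast
    have j_dist: "dist (fst p) (fst q) = mdist U (j p) (j q)" if "p \<in> P" "q \<in> P" for p q
      using i_dist[OF j(1)[OF that(1)] j(1)[OF that(2)]] j(2) that by simp
    define A where "A = j ` P"
    \<comment> \<open>Pairs over the same point have the same value by \<open>lip\<close>, so the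
      choice made by \<open>inv_into\<close> does not matter.\<close>
    define r where "r = (\<lambda>u. snd (inv_into P j u))"
    have r: "r (j p) = snd p" if p: "p \<in> P" for p
    proof -
      have q: "inv_into P j (j p) \<in> P" "j (inv_into P j (j p)) = j p"
        using p by (auto intro: inv_into_into f_inv_into_f)
      then have "fst (inv_into P j (j p)) = fst p"
        using j(2) p by metis
      then show ?thesis using lip[OF q(1) p] by (simp add: r_def)
    qed
    have A: "finite A" "A \<subseteq> mspace U" using P(1) j(1) by (auto simp: A_def)
    have Apos: "r u > 0" if "u \<in> A" for u using that pos by (auto simp: A_def r)
    have Ane: "r u \<noteq> 0" if "u \<in> A" for u using Apos[OF that] by simp
    have Alip: "\<bar>r u - r v\<bar> \<le> mdist U u v" "mdist U u v \<le> r u + r v" if "u \<in> A" "v \<in> A" for u v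
      using that lip sum by (auto simp: A_def r simp flip: j_dist)
    have Atri: "r v \<le> r u + mdist U u v" "r u \<le> mdist U u v + r v" if "u \<in> A" "v \<in> A" for u v
      using Alip(1)[OF that] by linarith+
    define d where "d = (\<lambda>x y. case (x, y) of (None, None) \<Rightarrow> 0 | (None, Some v) \<Rightarrow> r v
      | (Some u, None) \<Rightarrow> r u | (Some u, Some v) \<Rightarrow> mdist U u v)"
    define M where "M = insert None (Some ` A)"
    interpret U: Metric_space "mspace U" "mdist U" by (rule Metric_space_mspace_mdist)
    \<comment> \<open>Nonnegativity and symmetry are required at all arguments and not only on
      \<open>M\<close>, hence the value 0 outside.\<close>
    interpret X: Metric_space M "\<lambda>x y. if x \<in> M \<and> y \<in> M then d x y else 0"
    proof
      fix x y z
      let ?d = "\<lambda>x y. if x \<in> M \<and> y \<in> M then d x y else 0"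
      show "0 \<le> ?d x y"
        using A(2) Apos by (auto simp: M_def d_def less_imp_le split: option.splits)
      show "?d x y = ?d y x"
        by (auto simp: M_def d_def U.commute split: option.splits)
      assume x: "x \<in> M" and y: "y \<in> M"
      show "?d x y = 0 \<longleftrightarrow> x = y"
        using x y A(2) by (auto simp: Ane M_def d_def subset_iff split: option.splits)
      assume z: "z \<in> M"
      show "?d x z \<le> ?d x y + ?d y z"
        using x y z A(2)
        by (auto simp: M_def d_def subset_iff Atri Alip(2) U.triangle Apos less_imp_le
            split: option.splits)
    qed
    define X where "X = metric (M, \<lambda>x y. if x \<in> M \<and> y \<in> M then d x y else 0)"
    have X: "mspace X = M" "mdist X = (\<lambda>x y. if x \<in> M \<and> y \<in> M then d x y else 0)"
      by (simp_all add: X_def)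
    have "separable_space (mtopology_of X)"
      unfolding separable_space_def
    proof (intro exI[of _ M] conjI)
      show "countable M" using A(1) by (simp add: M_def countable_finite)
      show "M \<subseteq> topspace (mtopology_of X)" by (simp add: X)
      show "mtopology_of X closure_of M = topspace (mtopology_of X)"
        by (metis X(1) closure_of_topspace topspace_mtopology_of)
    qed
    then obtain f where f: "isometric_embedding X U f"
      using urysohn_space_universal[OF U] by blast
    have f_in: "f x \<in> mspace U" if "x \<in> M" for x
      using f that by (auto simp: isometric_embedding_def X)
    have f_dist: "mdist U (f x) (f y) = d x y" if "x \<in> M" "y \<in> M" for x y
      using f that by (auto simp: isometric_embedding_def X)
    have f_Some: "mdist U (f (Some u)) (f (Some v)) = mdist U u v" if "u \<in> A" "v \<in> A" for u v
      using that by (simp add: f_dist M_def d_def)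
    define g where "g = inv_into A (f \<circ> Some)"
    have "inj_on (f \<circ> Some) A"
    proof (rule inj_onI)
      fix u v assume uv: "u \<in> A" "v \<in> A" "(f \<circ> Some) u = (f \<circ> Some) v"
      then have "mdist U u v = 0"
        using f_Some[OF uv(1,2)] f_in[of "Some v"] by (simp add: M_def)
      then show "u = v" using uv A(2) by (simp add: subset_iff)
    qed
    then have g: "g (f (Some u)) = u" if "u \<in> A" for u
      using inv_into_f_f[of "f \<circ> Some" A u] that by (simp add: g_def)
    have fA: "f ` Some ` A \<subseteq> mspace U" using f_in by (auto simp: M_def)
    have gA: "g ` f ` Some ` A = A" by (auto simp: image_image g)
    have "mdist U (g x) (g y) = mdist U x y" if "x \<in> f ` Some ` A" "y \<in> f ` Some ` A" for x y
      using that g f_Some by auto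
    then have g_iso: "surjective_isometry (submetric U (f ` Some ` A)) (submetric U A) g"
      unfolding surjective_isometry_def isometric_embedding_def mspace_submetric mdist_submetric
        Int_absorb2[OF fA] Int_absorb2[OF A(2)] gA by simp
    have "ultrahomogeneous U" using U by (simp add: urysohn_space_def)
    then have "\<exists>h. surjective_isometry U U h \<and> (\<forall>x \<in> f ` Some ` A. h x = g x)"
      by (rule ultrahomogeneous_def[THEN iffD1, rule_format]) (use A fA g_iso in simp)
    then obtain h where h: "surjective_isometry U U h" "\<And>x. x \<in> f ` Some ` A \<Longrightarrow> h x = g x"
      by blast
    have "dist (i (h (f None))) (fst p) = snd p" if p: "p \<in> P" for p
    proof -
      have u: "j p \<in> A" using p by (simp add: A_def)
      have "mdist U (h (f None)) (h (f (Some (j p)))) = mdist U (f None) (f (Some (j p)))"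
        using h(1) f_in u by (auto simp: surjective_isometry_def isometric_embedding_def M_def)
      also have "\<dots> = snd p"
        using u p by (simp add: f_dist M_def d_def r)
      also have "h (f (Some (j p))) = j p"
        using h(2) g u by auto
      finally have "mdist U (h (f None)) (j p) = snd p" .
      moreover have "h (f None) \<in> mspace U"
        using h(1) f_in by (auto simp: surjective_isometry_def isometric_embedding_def M_def)
      ultimately show ?thesis
        using i_dist j p by metis
    qed
    moreover have "h (f None) \<in> mspace U"
      using h(1) f_in by (auto simp: surjective_isometry_def isometric_embedding_def M_def)
    ultimately show ?thesis by blast
  qed
qed

lemma urysohn_countable_dense:
  assumes U: "urysohn_space U" and i: "isometric_embedding U euclidean_metric i"
  obtains B where "countable B" "B \<subseteq> i ` mspace U" "i ` mspace U \<subseteq> closure B"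
proof -
  interpret U: Metric_space "mspace U" "mdist U" by (rule Metric_space_mspace_mdist)
  obtain C where C: "countable C" "C \<subseteq> mspace U" "U.mtopology closure_of C = mspace U"
    using U by (auto simp: urysohn_space_def separable_space_def mtopology_of_def)
  have "i u \<in> closure (i ` C)" if u: "u \<in> mspace U" for u
  proof (subst closure_approachable, intro allI impI)
    fix e :: real assume "e > 0"
    then obtain c where c: "c \<in> C" "mdist U u c < e"
      using C(3) u by (force simp: U.metric_closure_of)
    then have "dist (i c) (i u) < e"
      using i u C(2) by (auto simp: isometric_embedding_def subset_iff U.commute)
    then show "\<exists>y\<in>i ` C. dist y (i u) < e" using c by blast
  qed
  then show thesis
    using C by (intro that[of "i ` C"]) auto
qed

section \<open>Holmes' theorem\<close>

lemma hahn_banach_coordinate_diff: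
  fixes x :: "'k \<Rightarrow> 'e::real_normed_vector"
  assumes "finite S" and t: "\<And>c. (\<Sum>k\<in>S. c k * t k) \<le> norm (\<Sum>k\<in>S. c k *\<^sub>R x k)"
    and kl: "k \<in> S" "l \<in> S"
  shows "t k - t l \<le> norm (x k - x l)"
proof -
  define c where "c = (\<lambda>m. (if m = k then 1 else 0) - (if m = l then 1 else 0) :: real)"
  have "(\<Sum>m\<in>S. c m * t m) = t k - t l"
    using assms(1) kl by (simp add: c_def left_diff_distrib sum_subtractf if_distrib[of "\<lambda>r. r * _"] cong: if_cong)
  moreover have "(\<Sum>m\<in>S. c m *\<^sub>R x m) = x k - x l"
    using assms(1) kl
    by (simp add: c_def scaleR_left_diff_distrib sum_subtractf if_distrib[of "\<lambda>r. r *\<^sub>R _"] cong: if_cong)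
  ultimately show ?thesis using t[of c] by simp
qed

lemma sum_insert_None_Some:
  assumes "finite S"
  shows "sum h (insert None (Some ` S)) = h None + (\<Sum>k\<in>S. h (Some k))"
  using assms by (simp add: sum.reindex)

text \<open>Holmes' theorem: the norm of a combination with total weight zero is the Kantorovich norm. The
  two points \<open>y\<close>, \<open>z\<close> with distances \<open>C + f\<close> and \<open>C - f\<close> to the given points satisfy
  \<open>\<rho> y z = 2 C\<close>, so that a norming functional of \<open>J y - J z\<close> restricts to \<open>- f\<close> up to a constant.\<close>

lemma (in pseudometric) lipschitz_pairing_le_norm:
  fixes J :: "'a \<Rightarrow> 'e::real_normed_vector" and w :: "'k \<Rightarrow> 'a"
  assumes ext: "extension_property \<rho> UNIV" and J: "\<And>x y. dist (J x) (J y) = \<rho> x y"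
    and "finite S" and c: "(\<Sum>k\<in>S. c k) = 0"
    and lip: "\<And>k l. k \<in> S \<Longrightarrow> l \<in> S \<Longrightarrow> f k - f l \<le> \<rho> (w k) (w l)"
  shows "(\<Sum>k\<in>S. c k * f k) \<le> norm (\<Sum>k\<in>S. c k *\<^sub>R J (w k))"
proof -
  \<comment> \<open>Large enough for the Katetov conditions of \<open>C + f\<close>, of
    \<open>C - f\<close>, and of the value \<open>2 * C\<close> at \<open>y\<close>; these amount to
    the two bounds in \<open>fC\<close>.\<close>
  define C where "C = (\<Sum>k\<in>S. \<bar>f k\<bar>) + (\<Sum>k\<in>S. \<Sum>l\<in>S. \<rho> (w k) (w l))"
  have C1: "\<bar>f k\<bar> \<le> (\<Sum>k\<in>S. \<bar>f k\<bar>)" if "k \<in> S" for k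
    using \<open>finite S\<close> that by (intro member_le_sum) auto
  have C2: "\<rho> (w k) (w l) \<le> (\<Sum>k\<in>S. \<Sum>l\<in>S. \<rho> (w k) (w l))" if "k \<in> S" "l \<in> S" for k l
  proof -
    have "\<rho> (w k) (w l) \<le> (\<Sum>l\<in>S. \<rho> (w k) (w l))"
      using \<open>finite S\<close> that by (intro member_le_sum) auto
    also have "\<dots> \<le> (\<Sum>k\<in>S. \<Sum>l\<in>S. \<rho> (w k) (w l))"
      using \<open>finite S\<close> that by (intro member_le_sum[of k S "\<lambda>k. \<Sum>l\<in>S. \<rho> (w k) (w l)"] sum_nonneg) auto
    finally show ?thesis .
  qed
  have C0: "0 \<le> (\<Sum>k\<in>S. \<bar>f k\<bar>)" "0 \<le> (\<Sum>k\<in>S. \<Sum>l\<in>S. \<rho> (w k) (w l))"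
    by (intro sum_nonneg; simp)+
  have arith: "a + b + r \<le> 2 * (F + R)" if "a \<le> F" "b \<le> F" "r \<le> R" "0 \<le> R" for a b r F R :: real
    using that by argo
  have fC: "\<bar>f k\<bar> \<le> C" "\<bar>f k\<bar> + \<bar>f l\<bar> + \<rho> (w k) (w l) \<le> 2 * C" if "k \<in> S" "l \<in> S" for k l
    using C1[OF that(1)] C0(2) arith[OF C1[OF that(1)] C1[OF that(2)] C2[OF that] C0(2)]
    by (simp_all add: C_def)
  obtain y where y: "\<And>k. k \<in> S \<Longrightarrow> \<rho> y (w k) = C + f k"
  proof (rule extension_propertyD[OF ext \<open>finite S\<close>, of w "\<lambda>k. C + f k"])
    fix k l assume kl: "k \<in> S" "l \<in> S"
    show "\<bar>(C + f k) - (C + f l)\<bar> \<le> \<rho> (w k) (w l)"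
      using lip[OF kl] lip[OF kl(2,1)] sym[of "w k" "w l"] by linarith
    show "\<rho> (w k) (w l) \<le> C + f k + (C + f l)"
      using fC(2)[OF kl] by linarith
  qed auto
  \<comment> \<open>The index \<open>None\<close> stands for \<open>y\<close>, so that
    \<open>z\<close> is obtained from a single family and the same indices can be used for the
    functional.\<close>
  define v where "v = (\<lambda>k. case k of None \<Rightarrow> y | Some k \<Rightarrow> w k)"
  define a where "a = (\<lambda>k. case k of None \<Rightarrow> 2 * C | Some k \<Rightarrow> C - f k)"
  obtain z where z: "\<And>k. k \<in> insert None (Some ` S) \<Longrightarrow> \<rho> z (v k) = a k"
  proof (rule extension_propertyD[OF ext, of "insert None (Some ` S)" v a])
    have C: "0 \<le> C" using C0 by (simp add: C_def)
    fix k l assume "k \<in> insert None (Some ` S)" "l \<in> insert None (Some ` S)"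
    then consider "k = None" "l = None" | k' where "k = Some k'" "k' \<in> S" "l = None"
      | l' where "k = None" "l = Some l'" "l' \<in> S"
      | k' l' where "k = Some k'" "k' \<in> S" "l = Some l'" "l' \<in> S" by blast
    then have "\<bar>a k - a l\<bar> \<le> \<rho> (v k) (v l) \<and> \<rho> (v k) (v l) \<le> a k + a l"
    proof cases
      case 1
      then show ?thesis using C by (simp add: a_def v_def)
    next
      case 2
      then show ?thesis using fC(1)[of k' k'] y[of k'] sym[of "w k'" y] by (auto simp: a_def v_def)
    next
      case 3
      then show ?thesis using fC(1)[of l' l'] y[of l'] by (auto simp: a_def v_def)
    next
      case 4
      then show ?thesis
        using lip[of k' l'] lip[of l' k'] sym[of "w k'" "w l'"] fC(2)[of k' l']
        by (auto simp: a_def v_def)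
    qed
    then show "\<bar>a k - a l\<bar> \<le> \<rho> (v k) (v l)" "\<rho> (v k) (v l) \<le> a k + a l" by auto
  qed (use \<open>finite S\<close> in auto)
  have zy: "\<rho> y z = 2 * C"
    using z[of None] sym[of y z] by (simp add: a_def v_def)
  have zw: "\<rho> (w k) z = C - f k" if "k \<in> S" for k
    using z[of "Some k"] that sym[of "w k" z] by (simp add: a_def v_def)
  define S' where "S' = insert None (Some ` S)"
  have S': "finite S'" using \<open>finite S\<close> by (simp add: S'_def)
  note sum_S' = sum_insert_None_Some[OF \<open>finite S\<close>, folded S'_def]
  define u where "u = (\<lambda>k. J (v k) - J z)"
  obtain t where t: "\<And>d. (\<Sum>k\<in>S'. d k * t k) \<le> norm (\<Sum>k\<in>S'. d k *\<^sub>R u k)"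
    and t0: "(\<Sum>k\<in>S'. (case k of None \<Rightarrow> 1 | Some k \<Rightarrow> 0) * t k)
        = norm (\<Sum>k\<in>S'. (case k of None \<Rightarrow> 1 | Some k \<Rightarrow> 0) *\<^sub>R u k)"
    using hahn_banach_family[OF S', of u "case_option 1 (\<lambda>_. 0)"] by blast
  have tN: "t None = 2 * C"
    using t0 zy J[of y z] by (simp add: sum_S' u_def v_def dist_norm)
  \<comment> \<open>The functional drops by \<open>2 * C\<close> from \<open>y\<close> to
    \<open>z\<close>. The point \<open>w k\<close> lies metrically between them, at distances
    \<open>C + f k\<close> and \<open>C - f k\<close>, so neither part of the drop can be smaller
    than its distance.\<close>
  have tS: "t (Some k) = C - f k" if k: "k \<in> S" for k
  proof (rule antisym)
    have in_S': "None \<in> S'" "Some k \<in> S'" using k by (auto simp: S'_def)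
    have "t None - t (Some k) \<le> norm (u None - u (Some k))"
      by (rule hahn_banach_coordinate_diff[OF S' t in_S'])
    also have "\<dots> = C + f k"
      using y[OF k] J[of y "w k"] by (simp add: u_def v_def dist_norm)
    finally show "C - f k \<le> t (Some k)" using tN by simp
    have "(\<Sum>m\<in>S'. (if m = Some k then 1 else 0) * t m) \<le> norm (\<Sum>m\<in>S'. (if m = Some k then 1 else 0) *\<^sub>R u m)"
      by (rule t)
    then have "t (Some k) \<le> norm (u (Some k))"
      using S' in_S' by (simp add: if_distrib[of "\<lambda>r. r * _"] if_distrib[of "\<lambda>r. r *\<^sub>R _"] cong: if_cong)
    also have "\<dots> = C - f k"
      using zw[OF k] J[of "w k" z] by (simp add: u_def v_def dist_norm)
    finally show "t (Some k) \<le> C - f k" .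
  qed
  have "(\<Sum>k\<in>S. - c k * t (Some k)) \<le> norm (\<Sum>k\<in>S. - c k *\<^sub>R u (Some k))"
    using t[of "case_option 0 (\<lambda>k. - c k)"] by (simp add: sum_S')
  moreover have "(\<Sum>k\<in>S. - c k * t (Some k)) = (\<Sum>k\<in>S. c k * f k - C * c k)"
    by (intro sum.cong) (auto simp: tS algebra_simps)
  moreover have "(\<Sum>k\<in>S. c k * f k - C * c k) = (\<Sum>k\<in>S. c k * f k)"
    using c by (simp add: sum_subtractf flip: sum_distrib_left)
  moreover have "(\<Sum>k\<in>S. - c k *\<^sub>R u (Some k)) = - (\<Sum>k\<in>S. c k *\<^sub>R J (w k))"
    using c by (simp add: u_def v_def scaleR_diff_right sum_subtractf sum_negf flip: scaleR_left.sum)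
  ultimately show ?thesis by simp
qed

text \<open>A functional norming the combination of the \<open>w k\<close> takes values that are
  1-Lipschitz for their distances. These are also the distances of the \<open>w' k\<close>, so the
  values can be paired with the combination on that side.\<close>

lemma (in pseudometric) norm_combination_le:
  fixes J :: "'a \<Rightarrow> 'e::real_normed_vector" and w w' :: "'k \<Rightarrow> 'a"
  assumes ext: "extension_property \<rho> UNIV" and J: "\<And>x y. dist (J x) (J y) = \<rho> x y"
    and S: "finite S" and c: "(\<Sum>k\<in>S. c k) = 0"
    and w: "\<And>k l. k \<in> S \<Longrightarrow> l \<in> S \<Longrightarrow> \<rho> (w k) (w l) = \<rho> (w' k) (w' l)"
  shows "norm (\<Sum>k\<in>S. c k *\<^sub>R J (w k)) \<le> norm (\<Sum>k\<in>S. c k *\<^sub>R J (w' k))"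
proof -
  obtain t where t: "\<And>d. (\<Sum>k\<in>S. d k * t k) \<le> norm (\<Sum>k\<in>S. d k *\<^sub>R J (w k))"
    and t0: "(\<Sum>k\<in>S. c k * t k) = norm (\<Sum>k\<in>S. c k *\<^sub>R J (w k))"
    using hahn_banach_family[OF S, of "\<lambda>k. J (w k)" c] by blast
  have "(\<Sum>k\<in>S. c k * t k) \<le> norm (\<Sum>k\<in>S. c k *\<^sub>R J (w' k))"
  proof (rule lipschitz_pairing_le_norm[OF ext J S c])
    fix k l assume kl: "k \<in> S" "l \<in> S"
    have "t k - t l \<le> norm (J (w k) - J (w l))"
      by (rule hahn_banach_coordinate_diff[OF S t kl])
    then show "t k - t l \<le> \<rho> (w' k) (w' l)"
      using w[OF kl] by (simp add: J flip: dist_norm)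
  qed
  then show ?thesis using t0 by simp
qed

text \<open>Lists are formal combinations: the group acts on them before the action on vectors is
  known to be well defined.\<close>

definition comb :: "('a \<Rightarrow> 'e::real_vector) \<Rightarrow> (real \<times> 'a) list \<Rightarrow> 'e" where
  "comb J xs = (\<Sum>p\<leftarrow>xs. fst p *\<^sub>R J (snd p))"

definition weight :: "(real \<times> 'a) list \<Rightarrow> real" where
  "weight xs = (\<Sum>p\<leftarrow>xs. fst p)"

lemma comb_simps [simp]:
  "comb J [] = 0" "comb J (p # xs) = fst p *\<^sub>R J (snd p) + comb J xs"
  "comb J (xs @ ys) = comb J xs + comb J ys"
  by (simp_all add: comb_def)

lemma weight_simps [simp]:
  "weight [] = 0" "weight (p # xs) = fst p + weight xs" "weight (xs @ ys) = weight xs + weight ys"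
  by (simp_all add: weight_def)

lemma comb_scale [simp]: "comb J (map (apfst ((*) r)) xs) = r *\<^sub>R comb J xs"
  by (induction xs) (simp_all add: scaleR_add_right)

lemma weight_scale [simp]: "weight (map (apfst ((*) r)) xs) = r * weight xs"
  by (induction xs) (simp_all add: distrib_left)

lemma weight_apsnd [simp]: "weight (map (apsnd T) xs) = weight xs"
  by (induction xs) simp_all

lemma comb_sum: "comb J xs = (\<Sum>k<length xs. fst (xs ! k) *\<^sub>R J (snd (xs ! k)))"
  by (simp add: comb_def sum_list_sum_nth atLeast0LessThan)

lemma weight_sum: "weight xs = (\<Sum>k<length xs. fst (xs ! k))"
  by (simp add: weight_def sum_list_sum_nth atLeast0LessThan)

lemma map_apsnd_apfst: "map (apsnd T) (map (apfst r) xs) = map (apfst r) (map (apsnd T) xs)"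
  by simp

lemma (in pseudometric) norm_comb_map:
  fixes J :: "'a \<Rightarrow> 'e::real_normed_vector"
  assumes ext: "extension_property \<rho> UNIV" and J: "\<And>x y. dist (J x) (J y) = \<rho> x y"
    and T: "\<And>x y. \<rho> (T x) (T y) = \<rho> x y" and "weight xs = 0"
  shows "norm (comb J (map (apsnd T) xs)) = norm (comb J xs)"
proof -
  have c: "(\<Sum>k<length xs. fst (xs ! k)) = 0" using assms(4) by (simp add: weight_sum)
  have "norm (\<Sum>k<length xs. fst (xs ! k) *\<^sub>R J (T (snd (xs ! k))))
      = norm (\<Sum>k<length xs. fst (xs ! k) *\<^sub>R J (snd (xs ! k)))"
    by (intro antisym norm_combination_le[OF ext J _ c]) (auto simp: T)
  then show ?thesis by (simp add: comb_sum)
qed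

text \<open>Equal weights make the difference a formal combination of weight zero, to which
  \<open>norm_comb_map\<close> applies.\<close>

lemma dist_comb_map:
  fixes J :: "'a \<Rightarrow> 'e::real_normed_vector"
  assumes "pseudometric \<rho>" "extension_property \<rho> UNIV" "\<And>x y. dist (J x) (J y) = \<rho> x y"
    and "\<And>x y. \<rho> (T x) (T y) = \<rho> x y" and "weight xs = weight ys"
  shows "dist (comb J (map (apsnd T) xs)) (comb J (map (apsnd T) ys)) = dist (comb J xs) (comb J ys)"
proof -
  have *: "map (apsnd T) (xs @ map (apfst ((*) (- 1))) ys)
      = map (apsnd T) xs @ map (apfst ((*) (- 1))) (map (apsnd T) ys)"
    by (simp only: map_append map_apsnd_apfst)
  have "norm (comb J (map (apsnd T) (xs @ map (apfst ((*) (- 1))) ys)))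
      = norm (comb J (xs @ map (apfst ((*) (- 1))) ys))"
    by (rule pseudometric.norm_comb_map[OF assms(1-4)]) (simp only: weight_simps weight_scale assms(5))
  then show ?thesis
    unfolding * by (simp only: comb_simps comb_scale dist_norm) simp
qed

lemma subspace_closure:
  fixes S :: "'e::real_normed_vector set"
  assumes "subspace S"
  shows "subspace (closure S)"
proof (rule subspaceI)
  show "0 \<in> closure S"
    using subspace_0[OF assms] closure_subset by blast
  fix x assume x: "x \<in> closure S"
  then obtain f where f: "\<And>n. f n \<in> S" "f \<longlonglongrightarrow> x" by (auto simp: closure_sequential)
  show "r *\<^sub>R x \<in> closure S" for r
    unfolding closure_sequential using assms f
    by (intro exI[of _ "\<lambda>n. r *\<^sub>R f n"]) (auto intro: tendsto_intros subspace_scale)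
  fix y assume "y \<in> closure S"
  then obtain g where g: "\<And>n. g n \<in> S" "g \<longlonglongrightarrow> y" by (auto simp: closure_sequential)
  show "x + y \<in> closure S"
    unfolding closure_sequential using assms f g
    by (intro exI[of _ "\<lambda>n. f n + g n"]) (auto intro: tendsto_intros subspace_add)
qed

text \<open>Because \<open>J w0 = 0\<close>, the total weight can be corrected to one at
  \<open>w0\<close> without changing the vector, so the affine combinations already form a
  subspace.\<close>

lemma closure_span_eq_closure_affine_combs:
  fixes J :: "'a \<Rightarrow> 'e::real_normed_vector"
  assumes "B \<subseteq> range J" "D \<subseteq> closure B" "range J \<subseteq> closure (span D)" "J w0 = 0"
  shows "closure (span D) = closure {comb J xs | xs. weight xs = 1}"
proof -
  define A where "A = {comb J xs | xs. weight xs = 1}"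
  have A: "A = range (comb J)"
  proof
    show "range (comb J) \<subseteq> A"
    proof
      fix x assume "x \<in> range (comb J)"
      then obtain xs where "x = comb J xs" by blast
      then have "x = comb J ((1 - weight xs, w0) # xs)" "weight ((1 - weight xs, w0) # xs) = 1"
        by (simp_all add: assms(4))
      then show "x \<in> A" unfolding A_def by blast
    qed
  qed (auto simp: A_def)
  have sub: "subspace A"
    unfolding A
  proof (rule subspaceI)
    show "0 \<in> range (comb J)" by (rule range_eqI[of _ _ "[]"]) simp
    fix x assume "x \<in> range (comb J)"
    then obtain xs where xs: "x = comb J xs" by blast
    show "r *\<^sub>R x \<in> range (comb J)" for r
      by (rule range_eqI[of _ _ "map (apfst ((*) r)) xs"]) (simp only: xs comb_scale)
    fix y assume "y \<in> range (comb J)"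
    then obtain ys where ys: "y = comb J ys" by blast
    show "x + y \<in> range (comb J)"
      by (rule range_eqI[of _ _ "xs @ ys"]) (simp add: xs ys)
  qed
  have J: "range J \<subseteq> A"
  proof
    fix x assume "x \<in> range J"
    then obtain w where "x = comb J [(1, w)]" by auto
    then show "x \<in> A" unfolding A by blast
  qed
  have "D \<subseteq> closure A"
    using assms(1,2) J closure_mono[of B A] by blast
  then have "span D \<subseteq> closure A"
    using subspace_closure[OF sub] by (rule span_minimal)
  then have "closure (span D) \<subseteq> closure A"
    by (simp add: closure_minimal)
  moreover have "A \<subseteq> closure (span D)"
  proof -
    have sp: "subspace (closure (span D))" by (rule subspace_closure[OF subspace_span])
    have "comb J xs \<in> closure (span D)" for xs
      using assms(3)
      by (induction xs) (auto intro!: subspace_add[OF sp] subspace_scale[OF sp] subspace_0[OF sp])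
    then show ?thesis unfolding A by blast
  qed
  then have "closure A \<subseteq> closure (span D)"
    by (simp add: closure_minimal)
  ultimately show ?thesis unfolding A_def by blast
qed

section \<open>The affine action\<close>

lemma isometric_on_tendsto:
  fixes T :: "'e::metric_space \<Rightarrow> 'f::metric_space"
  assumes "\<And>x y. x \<in> E \<Longrightarrow> y \<in> E \<Longrightarrow> dist (T x) (T y) = dist x y"
    and "\<And>n. f n \<in> E" "x \<in> E" "f \<longlonglongrightarrow> x"
  shows "(\<lambda>n. T (f n)) \<longlonglongrightarrow> T x"
proof -
  have "(\<lambda>n. dist (T (f n)) (T x)) = (\<lambda>n. dist (f n) x)"
    using assms by simp
  moreover have "(\<lambda>n. dist (f n) x) \<longlonglongrightarrow> 0"
    using assms(4) by (rule tendsto_dist_iff[THEN iffD1])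
  ultimately show ?thesis by (metis tendsto_dist_iff)
qed

lemma isometric_on_closure_eq:
  fixes S T :: "'e::metric_space \<Rightarrow> 'f::metric_space"
  assumes "\<And>x y. x \<in> closure A \<Longrightarrow> y \<in> closure A \<Longrightarrow> dist (S x) (S y) = dist x y"
    and "\<And>x y. x \<in> closure A \<Longrightarrow> y \<in> closure A \<Longrightarrow> dist (T x) (T y) = dist x y"
    and "\<And>x. x \<in> A \<Longrightarrow> S x = T x" "x \<in> closure A"
  shows "S x = T x"
proof -
  obtain f where f: "\<And>n. f n \<in> A" "f \<longlonglongrightarrow> x"
    using assms(4) by (auto simp: closure_sequential)
  have fA: "f n \<in> closure A" for n using f(1) closure_subset by blast
  have "(\<lambda>n. S (f n)) \<longlonglongrightarrow> S x" "(\<lambda>n. T (f n)) \<longlonglongrightarrow> T x"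
    by (rule isometric_on_tendsto[where E = "closure A"]; use assms fA f in simp)+
  moreover have "(\<lambda>n. S (f n)) = (\<lambda>n. T (f n))" using assms(3) f(1) by simp
  ultimately show ?thesis by (metis LIMSEQ_unique)
qed

lemma affine_on_closure:
  fixes T :: "'e::real_normed_vector \<Rightarrow> 'f::real_normed_vector"
  assumes T: "\<And>x y. x \<in> closure A \<Longrightarrow> y \<in> closure A \<Longrightarrow> dist (T x) (T y) = dist x y"
    and A: "\<And>x y. x \<in> A \<Longrightarrow> y \<in> A \<Longrightarrow> u *\<^sub>R x + v *\<^sub>R y \<in> A \<and> T (u *\<^sub>R x + v *\<^sub>R y) = u *\<^sub>R T x + v *\<^sub>R T y"
    and xy: "x \<in> closure A" "y \<in> closure A"
  shows "T (u *\<^sub>R x + v *\<^sub>R y) = u *\<^sub>R T x + v *\<^sub>R T y"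
proof -
  obtain f where f: "\<And>n. f n \<in> A" "f \<longlonglongrightarrow> x"
    using xy(1) by (auto simp: closure_sequential)
  obtain g where g: "\<And>n. g n \<in> A" "g \<longlonglongrightarrow> y"
    using xy(2) by (auto simp: closure_sequential)
  have fA: "f n \<in> closure A" "g n \<in> closure A" "u *\<^sub>R f n + v *\<^sub>R g n \<in> closure A" for n
    using f(1)[of n] g(1)[of n] A closure_subset by blast+
  have lim: "(\<lambda>n. u *\<^sub>R f n + v *\<^sub>R g n) \<longlonglongrightarrow> u *\<^sub>R x + v *\<^sub>R y"
    by (intro tendsto_intros f g)
  have "u *\<^sub>R x + v *\<^sub>R y \<in> closure A"
    unfolding closure_sequential using lim A[OF f(1) g(1)]
    by (intro exI[of _ "\<lambda>n. u *\<^sub>R f n + v *\<^sub>R g n"]) simp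
  then have "(\<lambda>n. T (u *\<^sub>R f n + v *\<^sub>R g n)) \<longlonglongrightarrow> T (u *\<^sub>R x + v *\<^sub>R y)"
    by (intro isometric_on_tendsto[OF T fA(3)] lim)
  moreover have "(\<lambda>n. u *\<^sub>R T (f n) + v *\<^sub>R T (g n)) \<longlonglongrightarrow> u *\<^sub>R T x + v *\<^sub>R T y"
    by (intro tendsto_add tendsto_scaleR tendsto_const isometric_on_tendsto[OF T fA(1) xy(1) f(2)]
        isometric_on_tendsto[OF T fA(2) xy(2) g(2)])
  moreover have "(\<lambda>n. T (u *\<^sub>R f n + v *\<^sub>R g n)) = (\<lambda>n. u *\<^sub>R T (f n) + v *\<^sub>R T (g n))"
    using A f(1) g(1) by simp
  ultimately show ?thesis by (metis LIMSEQ_unique)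
qed

text \<open>Isometries are equicontinuous, so continuity of the orbit maps on a dense set gives
  joint continuity. The path from \<open>a g x\<close> through \<open>a g x0\<close>,
  \<open>a g p\<close> and \<open>a g0 p\<close> to \<open>a g0 x0\<close> has four steps of length
  below \<open>e / 4\<close>.\<close>

lemma isometric_family_continuous:
  fixes a :: "'g::topological_space \<Rightarrow> 'e::metric_space \<Rightarrow> 'f::metric_space"
  assumes iso: "\<And>g x y. x \<in> closure A \<Longrightarrow> y \<in> closure A \<Longrightarrow> dist (a g x) (a g y) = dist x y"
    and cont: "\<And>x. x \<in> A \<Longrightarrow> continuous_on UNIV (\<lambda>g. a g x)"
  shows "continuous_on (UNIV \<times> closure A) (\<lambda>(g, x). a g x)"
  unfolding continuous_on_topological
proof (intro ballI allI impI)
  fix q :: "'g \<times> 'e" and B :: "'f set"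
  assume q: "q \<in> UNIV \<times> closure A" and "open B" "(case q of (g, x) \<Rightarrow> a g x) \<in> B"
  obtain g0 x0 where q_eq: "q = (g0, x0)" "x0 \<in> closure A" using q by auto
  with \<open>open B\<close> \<open>(case q of (g, x) \<Rightarrow> a g x) \<in> B\<close> obtain e
    where e: "e > 0" "\<And>y. dist y (a g0 x0) < e \<Longrightarrow> y \<in> B"
    by (auto simp: open_dist)
  obtain p where p: "p \<in> A" "dist p x0 < e / 4"
    using q_eq(2) e(1) by (meson closure_approachable divide_pos_pos zero_less_numeral)
  then have pA: "p \<in> closure A" using closure_subset by blast
  define V where "V = {g. dist (a g p) (a g0 p) < e / 4}"
  have "open V"
    unfolding V_def by (intro open_Collect_less continuous_intros cont p)
  then have "open (V \<times> ball x0 (e / 4))" by (intro open_Times open_ball)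
  moreover have "q \<in> V \<times> ball x0 (e / 4)" using e(1) by (simp add: q_eq V_def)
  moreover have "(case r of (g, x) \<Rightarrow> a g x) \<in> B"
    if "r \<in> UNIV \<times> closure A" "r \<in> V \<times> ball x0 (e / 4)" for r
  proof -
    obtain g x where r: "r = (g, x)" "x \<in> closure A" "g \<in> V" "dist x0 x < e / 4"
      using \<open>r \<in> UNIV \<times> closure A\<close> \<open>r \<in> V \<times> ball x0 (e / 4)\<close> by auto
    have "dist (a g x) (a g x0) < e / 4" "dist (a g x0) (a g p) < e / 4" "dist (a g0 p) (a g0 x0) < e / 4"
      using iso r q_eq p pA by (simp_all add: dist_commute)
    moreover have "dist (a g p) (a g0 p) < e / 4" using r(3) by (simp add: V_def)
    ultimately have "dist (a g x) (a g0 x0) < e" by metric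
    then show ?thesis using e(2) r(1) by simp
  qed
  ultimately show "\<exists>C. open C \<and> q \<in> C \<and> (\<forall>y\<in>UNIV \<times> closure A. y \<in> C \<longrightarrow> (case y of (g, x) \<Rightarrow> a g x) \<in> B)"
    by blast
qed

text \<open>The group moves the points of weight-one combinations, which is isometric by
  \<open>dist_comb_map\<close>. The action laws and affinity are checked on these combinations and
  pass to the closure because all maps involved are isometric.\<close>

lemma affine_isometric_action_exists:
  fixes \<rho> :: "'w \<Rightarrow> 'w \<Rightarrow> real" and J :: "'w \<Rightarrow> 'e::banach"
    and act :: "'g::topological_group_add \<Rightarrow> 'w \<Rightarrow> 'w"
  assumes \<rho>: "pseudometric \<rho>" and ext: "extension_property \<rho> UNIV"
    and J: "\<And>x y. dist (J x) (J y) = \<rho> x y"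
    and act_iso: "\<And>g x y. \<rho> (act g x) (act g y) = \<rho> x y"
    and act_zero: "\<And>x. act 0 x = x" and act_add: "\<And>g h x. act (g + h) x = act g (act h x)"
    and act_cont: "\<And>x e. e > 0 \<Longrightarrow> \<exists>A. open A \<and> 0 \<in> A \<and> (\<forall>g \<in> A. \<rho> (act g x) x < e)"
    and E: "E = closure {comb J xs | xs. weight xs = 1}"
  obtains a where "continuous_affine_isometric_action E a"
    "\<And>g xs. weight xs = 1 \<Longrightarrow> a g (comb J xs) = comb J (map (apsnd (act g)) xs)"
proof -
  define A where "A = {comb J xs | xs. weight xs = 1}"
  have EA: "E = closure A" by (simp add: E A_def)
  have AE: "comb J xs \<in> E" if "weight xs = 1" for xs
    using that closure_subset by (force simp: EA A_def)
  \<comment> \<open>A vector may have several formal representations; that \<open>R g\<close> is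
    isometric shows that its image does not depend on the chosen one.\<close>
  define R where "R = (\<lambda>g. {(comb J xs, comb J (map (apsnd (act g)) xs)) | xs. weight xs = 1})"
  have iso_R: "isometric_relation dist (R g)" for g
    using dist_comb_map[OF \<rho> ext J, of "act g"] by (auto simp: isometric_relation_def R_def act_iso)
  have pm: "pseudometric (dist :: 'e \<Rightarrow> _)"
    by unfold_locales (simp, rule dist_commute, rule dist_triangle)
  have "\<exists>T. (\<forall>x \<in> E. \<forall>y \<in> E. dist (T x) (T y) = dist x y) \<and>
      (\<forall>xs. weight xs = 1 \<longrightarrow> T (comb J xs) = comb J (map (apsnd (act g)) xs)) \<and> (\<forall>x \<in> E. T x \<in> E)" for g
  proof -
    have dense: "\<exists>p \<in> R g. dist x (fst p) < e" if x: "x \<in> E" and e: "e > 0" for x e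
    proof -
      obtain y where "y \<in> A" "dist y x < e" using x e by (auto simp: EA closure_approachable)
      then show ?thesis by (force simp: A_def R_def dist_commute)
    qed
    obtain T where T: "\<And>x y. x \<in> E \<Longrightarrow> y \<in> E \<Longrightarrow> dist (T x) (T y) = dist x y"
      "\<And>x p. x \<in> E \<Longrightarrow> p \<in> R g \<Longrightarrow> dist (T x) (snd p) = dist x (fst p)"
      "\<And>x. x \<in> E \<Longrightarrow> T x \<in> closure (snd ` R g)"
      using pseudometric.isometric_relation_extend[OF pm iso_R, of E g] dense by metis
    have "T (comb J xs) = comb J (map (apsnd (act g)) xs)" if xs: "weight xs = 1" for xs
      using T(2)[OF AE[OF xs], of "(comb J xs, comb J (map (apsnd (act g)) xs))"] xs
      by (auto simp: R_def)
    moreover have "snd ` R g \<subseteq> A" by (auto simp: R_def A_def intro: exI weight_apsnd)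
    then have "T x \<in> E" if "x \<in> E" for x
      using T(3)[OF that] closure_mono[of "snd ` R g" A] by (auto simp: EA)
    ultimately show ?thesis using T(1) by blast
  qed
  then have "\<forall>g. \<exists>T. (\<forall>x \<in> E. \<forall>y \<in> E. dist (T x) (T y) = dist x y) \<and>
      (\<forall>xs. weight xs = 1 \<longrightarrow> T (comb J xs) = comb J (map (apsnd (act g)) xs)) \<and> (\<forall>x \<in> E. T x \<in> E)" ..
  from choice[OF this] obtain a where
    *: "\<forall>g. (\<forall>x \<in> E. \<forall>y \<in> E. dist (a g x) (a g y) = dist x y) \<and>
      (\<forall>xs. weight xs = 1 \<longrightarrow> a g (comb J xs) = comb J (map (apsnd (act g)) xs)) \<and> (\<forall>x \<in> E. a g x \<in> E)" ..
  have a_iso: "dist (a g x) (a g y) = dist x y" if "x \<in> E" "y \<in> E" for g x y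
    using * that by blast
  have a_comb: "a g (comb J xs) = comb J (map (apsnd (act g)) xs)" if "weight xs = 1" for g xs
    using * that by blast
  have a_E: "a g x \<in> E" if "x \<in> E" for g x
    using * that by blast
  have a_zero: "a 0 x = x" if "x \<in> E" for x
  proof (rule isometric_on_closure_eq[of A "a 0" "\<lambda>x. x"])
    show "a 0 y = y" if "y \<in> A" for y
      using that by (auto simp: A_def a_comb act_zero apsnd_def map_prod_def)
  qed (use a_iso that in \<open>simp_all add: EA\<close>)
  have a_add: "a (g + h) x = a g (a h x)" if "x \<in> E" for g h x
  proof (rule isometric_on_closure_eq[of A "a (g + h)" "\<lambda>x. a g (a h x)"])
    show "a (g + h) y = a g (a h y)" if "y \<in> A" for y
    proof -
      obtain xs where xs: "y = comb J xs" "weight xs = 1" using \<open>y \<in> A\<close> by (auto simp: A_def)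
      then have "weight (map (apsnd (act h)) xs) = 1" by simp
      moreover have "apsnd (act (g + h)) = apsnd (act g) \<circ> apsnd (act h)"
        by (auto simp: act_add)
      ultimately show ?thesis using a_comb xs by (metis map_map)
    qed
  qed (use a_iso a_E that in \<open>simp_all add: EA\<close>)
  have action: "action_on E a"
    using a_zero a_add a_E by (simp add: action_on_def)
  have affine: "affine_map_on E (a g)" for g
    unfolding affine_map_on_def
  proof (intro ballI allI impI)
    fix x y and u v :: real assume xy: "x \<in> E" "y \<in> E" and uv: "u + v = 1"
    show "a g (u *\<^sub>R x + v *\<^sub>R y) = u *\<^sub>R a g x + v *\<^sub>R a g y"
    proof (rule affine_on_closure[of A])
      fix p q assume "p \<in> A" "q \<in> A"
      then obtain xs ys where pq: "p = comb J xs" "weight xs = 1" "q = comb J ys" "weight ys = 1"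
        by (auto simp: A_def)
      define zs where "zs = map (apfst ((*) u)) xs @ map (apfst ((*) v)) ys"
      have wzs: "weight zs = 1"
        using uv by (simp only: zs_def weight_simps weight_scale pq)
      have zs: "comb J zs = u *\<^sub>R p + v *\<^sub>R q"
        by (simp only: zs_def comb_simps comb_scale pq)
      have "comb J (map (apsnd (act g)) zs) = u *\<^sub>R a g p + v *\<^sub>R a g q"
        by (simp only: zs_def map_append map_apsnd_apfst comb_simps comb_scale pq a_comb)
      then show "u *\<^sub>R p + v *\<^sub>R q \<in> A \<and> a g (u *\<^sub>R p + v *\<^sub>R q) = u *\<^sub>R a g p + v *\<^sub>R a g q"
        using zs wzs a_comb[OF wzs, of g] unfolding A_def
        by (metis (mono_tags, lifting) mem_Collect_eq)
    qed (use a_iso xy in \<open>simp_all add: EA\<close>)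
  qed
  have surj: "surjective_isometry (submetric euclidean_metric E) (submetric euclidean_metric E) (a g)" for g
  proof -
    have "a g ` E = E"
    proof
      show "E \<subseteq> a g ` E"
      proof
        fix x assume x: "x \<in> E"
        then have "x = a g (a (- g) x)"
          using a_add[OF x, of g "- g"] a_zero[OF x] by (metis add.right_inverse)
        then show "x \<in> a g ` E" using a_E[OF x] by blast
      qed
    qed (use a_E in blast)
    then show ?thesis
      by (simp add: surjective_isometry_def isometric_embedding_def a_iso)
  qed
  have J_cont: "continuous_on UNIV (\<lambda>g. J (act g x))" for x
    unfolding continuous_on_topological
  proof (intro ballI allI impI)
    fix h :: 'g and B assume "open B" "J (act h x) \<in> B"
    then obtain e where e: "e > 0" "\<And>y. dist y (J (act h x)) < e \<Longrightarrow> y \<in> B"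
      by (auto simp: open_dist)
    obtain V where V: "open V" "0 \<in> V" "\<And>g. g \<in> V \<Longrightarrow> \<rho> (act g x) x < e"
      using act_cont[OF e(1), of x] by auto
    define V' where "V' = (\<lambda>g. - h + g) -` V"
    have "J (act g x) \<in> B" if "g \<in> V'" for g
    proof (rule e(2))
      have "\<rho> (act g x) (act h x) = \<rho> (act h (act (- h + g) x)) (act h x)"
        by (simp flip: act_add)
      also have "\<dots> < e" using V(3) that by (simp add: V'_def act_iso)
      finally show "dist (J (act g x)) (J (act h x)) < e" by (simp add: J)
    qed
    moreover have "open V'" unfolding V'_def using V(1) by (intro open_vimage continuous_intros)
    moreover have "h \<in> V'" using V(2) by (simp add: V'_def)
    ultimately show "\<exists>C. open C \<and> h \<in> C \<and> (\<forall>g\<in>UNIV. g \<in> C \<longrightarrow> J (act g x) \<in> B)" by blast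
  qed
  have comb_cont: "continuous_on UNIV (\<lambda>g. comb J (map (apsnd (act g)) xs))" for xs
    by (induction xs) (auto intro!: continuous_intros J_cont)
  have "continuous_on (UNIV \<times> E) (\<lambda>(g, x). a g x)"
    unfolding EA
  proof (rule isometric_family_continuous)
    fix x assume "x \<in> A"
    then show "continuous_on UNIV (\<lambda>g. a g x)"
      using comb_cont by (auto simp: A_def a_comb)
  qed (use a_iso in \<open>simp add: EA\<close>)
  then have "continuous_affine_isometric_action E a"
    using action affine surj by (simp add: continuous_affine_isometric_action_def)
  then show thesis using a_comb that by blast
qed

section \<open>Absence of fixed points\<close>

lemma sum_bool_times:
  "sum h (UNIV \<times> {..<n}) = (\<Sum>k<n. h (False, k)) + (\<Sum>k<n :: nat. h (True, k))"
proof -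
  have "UNIV \<times> {..<n} = Pair False ` {..<n} \<union> Pair True ` {..<n}"
    by (auto simp: image_iff)
  moreover have "sum h (Pair False ` {..<n} \<union> Pair True ` {..<n})
      = sum h (Pair False ` {..<n}) + sum h (Pair True ` {..<n})"
    by (rule sum.union_disjoint) auto
  ultimately show ?thesis by (simp add: sum.reindex inj_on_def)
qed

text \<open>A combination within \<open>d / 2\<close> of a fixed point is moved by less than
  \<open>d\<close>. But its difference from a far translate, paired with the 1-Lipschitz function
  \<open>f\<close>, gives \<open>d\<close> because the total weight is one.\<close>

lemma no_fixed_point_if_far_translates:
  fixes \<rho> :: "'w \<Rightarrow> 'w \<Rightarrow> real" and J :: "'w \<Rightarrow> 'e::banach" and act :: "'g \<Rightarrow> 'w \<Rightarrow> 'w"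
  assumes \<rho>: "pseudometric \<rho>" and ext: "extension_property \<rho> UNIV"
    and J: "\<And>x y. dist (J x) (J y) = \<rho> x y"
    and act: "\<And>g x y. \<rho> (act g x) (act g y) = \<rho> x y"
    and far: "\<And>P. finite P \<Longrightarrow> \<exists>g. \<forall>p \<in> P. \<forall>q \<in> P. d \<le> \<rho> (act g p) q" and "d > 0"
    and E: "E = closure {comb J xs | xs. weight xs = 1}"
    and iso: "\<And>g x y. x \<in> E \<Longrightarrow> y \<in> E \<Longrightarrow> dist (a g x) (a g y) = dist x y"
    and a: "\<And>g xs. weight xs = 1 \<Longrightarrow> a g (comb J xs) = comb J (map (apsnd (act g)) xs)"
    and x: "x \<in> E" "\<And>g. a g x = x"
  shows False
proof -
  interpret pseudometric \<rho> by (rule \<rho>)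
  obtain y where "y \<in> {comb J xs | xs. weight xs = 1}" "dist y x < d / 2"
    using x(1) \<open>d > 0\<close> unfolding E closure_approachable by (meson half_gt_zero)
  then obtain xs where xs: "weight xs = 1" "dist (comb J xs) x < d / 2" by blast
  have "comb J xs \<in> {comb J xs | xs. weight xs = 1}" using xs(1) by blast
  then have xsE: "comb J xs \<in> E" unfolding E by (rule closure_subset[THEN subsetD])
  obtain g where g: "\<And>p q. p \<in> snd ` set xs \<Longrightarrow> q \<in> snd ` set xs \<Longrightarrow> d \<le> \<rho> (act g p) q"
    using far[OF finite_imageI[OF finite_set], of snd xs] by blast
  define n where "n = length xs"
  \<comment> \<open>\<open>True\<close> indexes the translated points and \<open>False\<close> the
    original ones, which enter with the opposite sign.\<close>
  define S :: "(bool \<times> nat) set" where "S = UNIV \<times> {..<n}"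
  define c where "c = (\<lambda>(b, k). (if b then 1 else - 1) * fst (xs ! k))"
  define w where "w = (\<lambda>(b, k). (if b then act g else id) (snd (xs ! k)))"
  define f where "f = (\<lambda>(b :: bool, k :: nat). if b then d else 0)"
  have "(\<Sum>k\<in>S. c k * f k) \<le> norm (\<Sum>k\<in>S. c k *\<^sub>R J (w k))"
  proof (rule lipschitz_pairing_le_norm[OF ext J])
    show "(\<Sum>k\<in>S. c k) = 0"
      by (simp add: sum_bool_times S_def c_def sum_negf)
    fix k l assume "k \<in> S" "l \<in> S"
    then show "f k - f l \<le> \<rho> (w k) (w l)"
      using g \<open>d > 0\<close> order_trans[OF _ nonneg[of "w k" "w l"], of "- d"]
      by (auto simp: S_def f_def w_def n_def)
  qed (simp add: S_def)
  also have "(\<Sum>k\<in>S. c k * f k) = d"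
    using xs(1) by (simp add: sum_bool_times S_def c_def f_def weight_sum n_def flip: sum_distrib_right)
  also have "(\<Sum>k\<in>S. c k *\<^sub>R J (w k)) = comb J (map (apsnd (act g)) xs) - comb J xs"
    by (simp add: sum_bool_times S_def c_def w_def comb_sum n_def sum_negf)
  also have "norm \<dots> = dist (a g (comb J xs)) (comb J xs)"
    by (simp add: a xs(1) dist_norm)
  also have "\<dots> \<le> dist (a g (comb J xs)) (a g x) + dist x (comb J xs)"
    using dist_triangle[of "a g (comb J xs)" "comb J xs" x] by (simp add: x(2))
  also have "\<dots> < d"
    using xs(2) iso[OF xsE x(1), of g] by (simp add: dist_commute)
  finally show False by simp
qed

lemma separable_imp_omega_bounded_group:
  assumes "separable_space (euclidean :: 'g::{topological_group_add, t2_space} topology)"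
  shows "omega_bounded_group TYPE('g)"
  unfolding omega_bounded_group_def
proof (intro allI impI, elim conjE)
  fix V :: "'g set" assume V: "open V" "V \<noteq> {}"
  obtain D :: "'g set" where D: "countable D" "closure D = UNIV"
    using assms by (auto simp: separable_space_def)
  have "g \<in> D + V" for g
  proof -
    define W where "W = (\<lambda>x. - x + g) -` V"
    have "open W"
      unfolding W_def using V(1) by (intro open_vimage continuous_intros)
    obtain v where "v \<in> V" using V(2) by blast
    have "- (g - v) + g = v" by (simp add: add.assoc diff_conv_add_uminus minus_add del: add_uminus_conv_diff)
    then have "g - v \<in> W" using \<open>v \<in> V\<close> by (simp add: W_def)
    then have "W \<inter> D \<noteq> {}"
      using open_Int_closure_eq_empty[OF \<open>open W\<close>, of D] D(2) by auto
    then obtain x where x: "x \<in> D" "- x + g \<in> V" by (auto simp: W_def)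
    have "g = x + (- x + g)" by simp
    then show ?thesis using x by (metis set_plus_intro)
  qed
  then show "\<exists>F. countable F \<and> F + V = UNIV" using D(1) by blast
qed

lemma fixed_point_free_action_exists:
  fixes U :: "'u metric" and i :: "'u \<Rightarrow> 'e::banach" and V :: "'g::{topological_group_add, t2_space} set"
  assumes omega: "omega_bounded_group TYPE('g)" and holmes: "holmes_space U i E"
    and V: "0 \<in> interior V" "\<nexists>F. finite F \<and> F + V = UNIV"
  shows "\<exists>a :: 'g \<Rightarrow> 'e \<Rightarrow> 'e. continuous_affine_isometric_action E a \<and> (\<nexists>x. x \<in> E \<and> (\<forall>g. a g x = x))"
proof -
  have U: "urysohn_space U" and i: "isometric_embedding U euclidean_metric i"
    and "0 \<in> i ` mspace U" and E: "E = closure (span (i ` mspace U))"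
    using holmes by (auto simp: holmes_space_def)
  obtain N d where "group_seminorm N" and d: "d > 0" "\<And>x. N x < d \<Longrightarrow> x \<in> interior V"
    using group_seminorm_exists[OF open_interior V(1)] by blast
  interpret group_seminorm N by fact
  interpret pseudometric limit_dist by (rule pseudometric_limit)
  define D where "D = i ` mspace U"
  obtain B where B: "countable B" "B \<subseteq> D" "D \<subseteq> closure B"
    using urysohn_countable_dense[OF U i] unfolding D_def by blast
  have "\<exists>A. countable A \<and> (\<forall>p. \<forall>e > 0. \<exists>q \<in> A. limit_dist p q < e)"
    using omega by (intro limit_separable) (auto simp: omega_bounded_group_def)
  then obtain A where A: "countable A" "\<And>p e. e > 0 \<Longrightarrow> \<exists>q \<in> A. limit_dist p q < e"
    by blast
  \<comment> \<open>\<open>B\<close> ensures that the image of \<open>J\<close> is dense in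
    \<open>D\<close>; \<open>0\<close> has to be an exact value of \<open>J\<close> for the weight
    correction at \<open>w0\<close>.\<close>
  obtain R where R: "isometric_relation limit_dist R" "A \<subseteq> fst ` R" "insert 0 B \<subseteq> snd ` R" "snd ` R \<subseteq> D"
  proof (rule back_and_forth[OF limit_extension urysohn_extension_property[OF U i] A(1)])
    show "countable (insert 0 B)" "insert 0 B \<subseteq> i ` mspace U"
      using B \<open>0 \<in> i ` mspace U\<close> by (auto simp: D_def)
  qed (auto simp: D_def)
  have dense: "\<exists>p \<in> R. limit_dist x (fst p) < e" if "x \<in> UNIV" and e: "e > 0" for x e
  proof -
    obtain q where q: "q \<in> A" "limit_dist x q < e" using A(2)[OF e] by blast
    then obtain p where "p \<in> R" "q = fst p" using R(2) by blast
    then show ?thesis using q(2) by blast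
  qed
  obtain J where J': "\<And>x y. x \<in> UNIV \<Longrightarrow> y \<in> UNIV \<Longrightarrow> dist (J x) (J y) = limit_dist x y"
    and JR': "\<And>x p. x \<in> UNIV \<Longrightarrow> p \<in> R \<Longrightarrow> dist (J x) (snd p) = limit_dist x (fst p)"
    and J_closure': "\<And>x. x \<in> UNIV \<Longrightarrow> J x \<in> closure (snd ` R)"
    using isometric_relation_extend[OF R(1) dense] by metis
  note J = J'[OF UNIV_I UNIV_I] and JR = JR'[OF UNIV_I] and J_closure = J_closure'[OF UNIV_I]
  have J_snd: "J (fst p) = snd p" if "p \<in> R" for p
    using JR[OF that, of "fst p"] by simp
  have BJ: "insert 0 B \<subseteq> range J"
  proof
    fix b assume "b \<in> insert 0 B"
    then obtain p where "p \<in> R" "b = snd p" using R(3) by blast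
    then show "b \<in> range J" using J_snd[of p] by (metis rangeI)
  qed
  then obtain w0 where w0: "J w0 = 0" by auto
  have "range J \<subseteq> closure (span D)"
  proof -
    have "snd ` R \<subseteq> span D" using R(4) span_superset by blast
    then have "closure (snd ` R) \<subseteq> closure (span D)" by (rule closure_mono)
    then show ?thesis using J_closure by blast
  qed
  moreover have "D \<subseteq> closure (insert 0 B)" using B(3) closure_mono[of B "insert 0 B"] by blast
  ultimately have E_comb: "E = closure {comb J xs | xs. weight xs = 1}"
    using closure_span_eq_closure_affine_combs[OF BJ _ _ w0, of D] by (simp add: E D_def)
  obtain a :: "'g \<Rightarrow> 'e \<Rightarrow> 'e" where a: "continuous_affine_isometric_action E a"
    "\<And>g xs. weight xs = 1 \<Longrightarrow> a g (comb J xs) = comb J (map (apsnd (limit_act g)) xs)"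
    using affine_isometric_action_exists[OF pseudometric_limit limit_extension J limit_dist_act
        limit_act_zero limit_act_add limit_orbit_continuous E_comb] by metis
  have iso: "dist (a g x) (a g y) = dist x y" if "x \<in> E" "y \<in> E" for g x y
    using a(1) that
    by (auto simp: continuous_affine_isometric_action_def surjective_isometry_def isometric_embedding_def)
  \<comment> \<open>Half of \<open>d\<close>, because differences of two elements of the
    \<open>d / 2\<close>-ball have to stay in \<open>V\<close>.\<close>
  have far: "\<exists>g. \<forall>p \<in> P. \<forall>q \<in> P. d / 2 \<le> limit_dist (limit_act g p) q" if "finite P" for P
    using d interior_subset V(2) that by (intro limit_far_translate[of _ V]) auto
  have False if "x \<in> E" "\<And>g. a g x = x" for x
    by (rule no_fixed_point_if_far_translates[OF pseudometric_limit limit_extension J limit_dist_act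
        far half_gt_zero[OF d(1)] E_comb iso a(2) that])
  then show ?thesis using a(1) by blast
qed

section \<open>Fixed points of precompact groups\<close>

text \<open>Mazur's theorem: the hull of \<open>S\<close> stays within \<open>e / 4\<close> of the
  hull of a finite net, which is compact and so has a finite net of its own. Passing to the closure
  costs a third \<open>e / 4\<close>.\<close>

lemma compact_closure_convex_hull:
  fixes S :: "'e::banach set"
  assumes tb: "\<And>e. e > 0 \<Longrightarrow> \<exists>F. finite F \<and> S \<subseteq> (\<Union>x \<in> F. ball x e)"
  shows "compact (closure (convex hull S))"
  unfolding compact_eq_totally_bounded
proof (intro conjI allI impI)
  show "complete (closure (convex hull S))"
    by (simp add: complete_eq_closed)
  fix e :: real assume e: "e > 0"
  obtain F where F: "finite F" "S \<subseteq> (\<Union>x \<in> F. ball x (e / 4))"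
    using tb[of "e / 4"] e by auto
  have "compact (convex hull F)" using F(1) by (rule finite_imp_compact_convex_hull)
  then obtain K where K: "finite K" "convex hull F \<subseteq> (\<Union>x \<in> K. ball x (e / 4))"
    unfolding compact_eq_totally_bounded using e by (meson divide_pos_pos zero_less_numeral)
  have "S \<subseteq> convex hull F + ball 0 (e / 4)"
  proof
    fix s assume "s \<in> S"
    then obtain x where x: "x \<in> F" "dist x s < e / 4" using F(2) by auto
    have "x \<in> convex hull F" using x(1) by (rule hull_inc)
    moreover have "s - x \<in> ball 0 (e / 4)" using x(2) by (simp add: dist_norm norm_minus_commute)
    ultimately have "x + (s - x) \<in> convex hull F + ball 0 (e / 4)" by (rule set_plus_intro)
    then show "s \<in> convex hull F + ball 0 (e / 4)" by simp
  qed
  then have hull: "convex hull S \<subseteq> convex hull F + ball 0 (e / 4)"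
    by (rule hull_minimal) (simp add: convex_set_plus)
  have "closure (convex hull S) \<subseteq> (\<Union>x \<in> K. ball x e)"
  proof
    fix z assume "z \<in> closure (convex hull S)"
    then obtain y where y: "y \<in> convex hull S" "dist y z < e / 4"
      using e closure_approachable[of z "convex hull S"]
      by (metis divide_pos_pos zero_less_numeral)
    have "y \<in> convex hull F + ball 0 (e / 4)" using hull y(1) by (rule subsetD)
    then obtain x v where xv: "x \<in> convex hull F" "v \<in> ball 0 (e / 4)" "y = x + v"
      by (rule set_plus_elim)
    obtain k where k: "k \<in> K" "dist k x < e / 4" using K(2) xv(1) by auto
    have "dist x y < e / 4" using xv by (simp add: dist_norm)
    then have "dist k z < e"
      using k(2) y(2) e dist_triangle[of k z x] dist_triangle[of x z y] by linarith
    then show "z \<in> (\<Union>x \<in> K. ball x e)" using k(1) by auto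
  qed
  then show "\<exists>k. finite k \<and> closure (convex hull S) \<subseteq> (\<Union>x \<in> k. ball x e)" using K(1) by blast
qed

text \<open>Normal structure of compact convex sets: averaging a finite \<open>D/2\<close>-net gives a point whose distances
  to the set stay below the diameter \<open>D\<close> by a definite amount.\<close>

lemma compact_convex_nondiametral_point:
  fixes C :: "'e::real_normed_vector set"
  assumes C: "compact C" "convex C" and D: "diameter C > 0"
  obtains u r where "u \<in> C" "r < diameter C" "\<And>y. y \<in> C \<Longrightarrow> dist u y \<le> r"
proof -
  define D where "D = diameter C"
  have "D > 0" using assms(3) by (simp add: D_def)
  have dist_le: "dist x y \<le> D" if "x \<in> C" "y \<in> C" for x y
    unfolding D_def using diameter_bounded_bound[OF compact_imp_bounded[OF C(1)]] that by blast
  have "C \<noteq> {}" using assms(3) by auto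
  have "C \<subseteq> (\<Union>c \<in> C. ball c (D / 2))" using \<open>D > 0\<close> by auto
  then obtain F where F: "F \<subseteq> C" "finite F" "C \<subseteq> (\<Union>c \<in> F. ball c (D / 2))"
    using compactE_image[OF C(1), of C "\<lambda>c. ball c (D / 2)"] by (metis open_ball)
  then have "F \<noteq> {}" using \<open>C \<noteq> {}\<close> by auto
  define n where "n = real (card F)"
  have n: "n > 0" using F(2) \<open>F \<noteq> {}\<close> by (simp add: n_def card_gt_0_iff)
  define u where "u = (\<Sum>k\<in>F. (1 / n) *\<^sub>R k)"
  have "u \<in> C"
    unfolding u_def using F n by (intro convex_sum[OF F(2) C(2)]) (auto simp: n_def)
  moreover have "D - D / (2 * n) < D" using n \<open>D > 0\<close> by simp
  \<comment> \<open>One of the \<open>n\<close> net points is within \<open>D / 2\<close> of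
    \<open>y\<close> and the others within \<open>D\<close>; the bound is the average of these
    distances.\<close>
  moreover have "dist u y \<le> D - D / (2 * n)" if y: "y \<in> C" for y
  proof -
    obtain c where c: "c \<in> F" "dist c y < D / 2" using F(3) y by auto
    have "u - y = (\<Sum>k\<in>F. (1 / n) *\<^sub>R (k - y))"
      using n by (simp add: u_def scaleR_diff_right sum_subtractf n_def flip: scaleR_left.sum)
    then have "dist u y \<le> (\<Sum>k\<in>F. norm ((1 / n) *\<^sub>R (k - y)))"
      by (simp only: dist_norm norm_sum)
    also have "\<dots> = (1 / n) * (\<Sum>k\<in>F. dist k y)"
      using n by (simp add: sum_divide_distrib dist_norm)
    finally have le: "dist u y \<le> (1 / n) * (\<Sum>k\<in>F. dist k y)" .
    have "(\<Sum>k\<in>F - {c}. dist k y) \<le> (\<Sum>k\<in>F - {c}. D)"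
      using F(1) y dist_le by (intro sum_mono) auto
    also have "(\<Sum>k\<in>F - {c}. D) = (n - 1) * D"
      using n F(2) c(1) by (simp add: n_def of_nat_diff Suc_le_eq)
    finally have "(\<Sum>k\<in>F. dist k y) \<le> D / 2 + (n - 1) * D"
      using c(2) sum.remove[OF F(2) c(1), of "\<lambda>k. dist k y"] by linarith
    then have "(1 / n) * (\<Sum>k\<in>F. dist k y) \<le> (1 / n) * (D / 2 + (n - 1) * D)"
      using n by (intro mult_left_mono) auto
    also have "\<dots> = D - D / (2 * n)" using n by (simp add: field_simps)
    finally show ?thesis using le by (rule order_trans[rotated])
  qed
  ultimately show thesis using that unfolding D_def by blast
qed

text \<open>In a minimal invariant set \<open>C\<close> of positive diameter, the points within
  \<open>r < diameter C\<close> of all of \<open>C\<close> would form a nonempty invariant closed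
  convex subset. By minimality this is \<open>C\<close> itself, whose diameter would then be at most
  \<open>r\<close>.\<close>

lemma isometric_action_fixed_point:
  fixes K :: "'e::real_normed_vector set" and a :: "'g::group_add \<Rightarrow> 'e \<Rightarrow> 'e"
  assumes K: "compact K" "convex K" "K \<noteq> {}" and inv: "\<And>g x. x \<in> K \<Longrightarrow> a g x \<in> K"
    and iso: "\<And>g x y. x \<in> K \<Longrightarrow> y \<in> K \<Longrightarrow> dist (a g x) (a g y) = dist x y"
    and zero: "\<And>x. x \<in> K \<Longrightarrow> a 0 x = x" and add: "\<And>g h x. x \<in> K \<Longrightarrow> a (g + h) x = a g (a h x)"
  shows "\<exists>x \<in> K. \<forall>g. a g x = x"
proof -
  have "closed K" using K(1) by (rule compact_imp_closed)
  define \<A> where "\<A> = {C. C \<subseteq> K \<and> closed C \<and> convex C \<and> C \<noteq> {} \<and> (\<forall>g. \<forall>x \<in> C. a g x \<in> C)}"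
  have "\<exists>M \<in> \<A>. \<forall>C \<in> \<A>. C \<subseteq> M \<longrightarrow> C = M"
  \<comment> \<open>Zorn's lemma for reverse inclusion. Lower bounds are intersections, taken
    together with \<open>K\<close> to cover the empty chain.\<close>
  proof (rule predicate_Zorn[where P = "\<lambda>A B. B \<subseteq> A"])
    show "partial_order_on \<A> (relation_of (\<lambda>A B. B \<subseteq> A) \<A>)"
      by (auto simp: partial_order_on_def preorder_on_def refl_on_def trans_def antisym_def relation_of_def)
    fix \<C> assume "\<C> \<in> Chains (relation_of (\<lambda>A B. B \<subseteq> A) \<A>)"
    then have \<C>: "\<C> \<subseteq> \<A>" "\<And>A B. A \<in> \<C> \<Longrightarrow> B \<in> \<C> \<Longrightarrow> A \<subseteq> B \<or> B \<subseteq> A"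
      by (auto simp: Chains_def relation_of_def)
    have "K \<inter> \<Inter>\<C> \<noteq> {}"
    proof (rule compact_imp_fip[OF K(1)])
      show "closed T" if "T \<in> \<C>" for T using that \<C>(1) by (auto simp: \<A>_def)
      fix \<F> assume \<F>: "finite \<F>" "\<F> \<subseteq> \<C>"
      show "K \<inter> \<Inter>\<F> \<noteq> {}"
      proof (cases "\<F> = {}")
        case False
        have "\<exists>T \<in> \<F>. T \<subseteq> \<Inter>\<F>"
          using \<F>(1) False \<F>(2)
        proof (induction \<F> rule: finite_ne_induct)
          case (insert T \<F>)
          then obtain T' where "T' \<in> \<F>" "T' \<subseteq> \<Inter>\<F>" by blast
          moreover have "T \<subseteq> T' \<or> T' \<subseteq> T" using insert.prems \<open>T' \<in> \<F>\<close> by (intro \<C>(2)) auto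
          ultimately show ?case by auto
        qed auto
        then obtain T where "T \<in> \<F>" "T \<subseteq> \<Inter>\<F>" by blast
        moreover have "T \<subseteq> K" "T \<noteq> {}" using \<open>T \<in> \<F>\<close> \<F>(2) \<C>(1) by (auto simp: \<A>_def)
        ultimately show ?thesis by blast
      qed (use K(3) in simp)
    qed
    moreover have "convex (K \<inter> \<Inter>\<C>)" "closed (K \<inter> \<Inter>\<C>)"
      using \<C>(1) K(2) \<open>closed K\<close>
      by (auto simp: \<A>_def intro!: convex_Int convex_Inter closed_Int closed_Inter)
    moreover have "a g x \<in> K \<inter> \<Inter>\<C>" if "x \<in> K \<inter> \<Inter>\<C>" for g x
      using that \<C>(1) inv by (auto simp: \<A>_def)
    ultimately have "K \<inter> \<Inter>\<C> \<in> \<A>" by (auto simp: \<A>_def)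
    then show "\<exists>M \<in> \<A>. \<forall>C \<in> \<C>. M \<subseteq> C" by (intro bexI[of _ "K \<inter> \<Inter>\<C>"]) auto
  qed
  then obtain C where C: "C \<in> \<A>" and minimal: "\<And>C'. C' \<in> \<A> \<Longrightarrow> C' \<subseteq> C \<Longrightarrow> C' = C" by blast
  have C': "C \<subseteq> K" "closed C" "convex C" "C \<noteq> {}" "\<And>g x. x \<in> C \<Longrightarrow> a g x \<in> C"
    using C by (auto simp: \<A>_def)
  have "compact C" using C'(1,2) K(1) by (metis compact_Int_closed inf.absorb_iff2)
  have diam: "diameter C = 0"
  proof (rule ccontr)
    assume "diameter C \<noteq> 0"
    then have "diameter C > 0"
      using diameter_ge_0[OF compact_imp_bounded[OF \<open>compact C\<close>]] by simp
    then obtain u r where u: "u \<in> C" "r < diameter C" "\<And>y. y \<in> C \<Longrightarrow> dist u y \<le> r"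
      using compact_convex_nondiametral_point[OF \<open>compact C\<close> C'(3)] by blast
    \<comment> \<open>This set is invariant because every \<open>a g\<close> maps \<open>C\<close>
      onto \<open>C\<close>: a point \<open>y\<close> of \<open>C\<close> is the image of
      \<open>a (- g) y\<close>.\<close>
    define C1 where "C1 = C \<inter> (\<Inter>y \<in> C. cball y r)"
    have "closed C1" "convex C1"
      using C'(2,3) by (auto simp: C1_def intro!: convex_Int convex_INT closed_Int closed_INT)
    moreover have "u \<in> C1" using u by (auto simp: C1_def dist_commute)
    moreover have "a g x \<in> C1" if x: "x \<in> C1" for g x
    proof -
      have "dist y (a g x) \<le> r" if y: "y \<in> C" for y
      proof -
        have yK: "y \<in> K" "a (- g) y \<in> K" "x \<in> K" using C'(1,5) y x by (auto simp: C1_def)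
        have "y = a g (a (- g) y)"
          using add[OF yK(1), of g "- g"] zero[OF yK(1)] by (metis add.right_inverse)
        then have "dist y (a g x) = dist (a (- g) y) x" using iso[OF yK(2,3), of g] by metis
        then show ?thesis using x C'(5)[OF y] by (auto simp: C1_def)
      qed
      then show ?thesis using x C'(5) by (auto simp: C1_def)
    qed
    ultimately have "C1 \<in> \<A>" using C'(1) by (auto simp: \<A>_def C1_def)
    then have "C1 = C" by (rule minimal) (simp add: C1_def)
    have "dist x y \<le> r" if "x \<in> C" "y \<in> C" for x y
    proof -
      have "y \<in> C1" using that \<open>C1 = C\<close> by simp
      then show ?thesis using that(1) by (simp add: C1_def)
    qed
    then have "diameter C \<le> r"
      using C'(4) by (intro diameter_le) (auto simp: dist_norm)
    then show False using u(2) by simp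
  qed
  obtain x where x: "x \<in> C" using C'(4) by blast
  have "a g x = x" for g
    using diameter_bounded_bound[OF compact_imp_bounded[OF \<open>compact C\<close>] C'(5)[OF x] x] diam by simp
  then show ?thesis using x C'(1) by blast
qed

lemma precompact_group_fixed_point:
  fixes a :: "'g::{topological_group_add, t2_space} \<Rightarrow> 'e::banach \<Rightarrow> 'e"
  assumes G: "precompact_group TYPE('g)" and a: "continuous_affine_isometric_action E a"
    and E: "closed E" "convex E" "E \<noteq> {}"
  shows "\<exists>x \<in> E. \<forall>g. a g x = x"
proof -
  have a_E: "a g x \<in> E" and a_zero: "a 0 x = x" and a_add: "a (g + h) x = a g (a h x)"
    if "x \<in> E" for g h x
    using a that by (auto simp: continuous_affine_isometric_action_def action_on_def)
  have iso: "dist (a g x) (a g y) = dist x y" if "x \<in> E" "y \<in> E" for g x y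
    using a that
    by (auto simp: continuous_affine_isometric_action_def surjective_isometry_def isometric_embedding_def)
  have affine: "a g (u *\<^sub>R x + v *\<^sub>R y) = u *\<^sub>R a g x + v *\<^sub>R a g y"
    if "x \<in> E" "y \<in> E" "u + v = 1" for g x y u v
    using a that by (auto simp: continuous_affine_isometric_action_def affine_map_on_def)
  obtain x0 where x0: "x0 \<in> E" using E(3) by blast
  have cont: "continuous_on UNIV (\<lambda>g. a g x0)"
  proof -
    have "continuous_on (UNIV \<times> E) (\<lambda>(g, x). a g x)"
      using a by (simp add: continuous_affine_isometric_action_def)
    then have "continuous_on UNIV ((\<lambda>(g, x). a g x) \<circ> (\<lambda>g. (g, x0)))"
      using x0 by (intro continuous_on_compose continuous_intros) (auto elim: continuous_on_subset)
    then show ?thesis by (simp add: comp_def)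
  qed
  define S where "S = range (\<lambda>g. a g x0)"
  have SE: "S \<subseteq> E" using a_E x0 by (auto simp: S_def)
  define K where "K = closure (convex hull S)"
  have "compact K"
    unfolding K_def
  proof (rule compact_closure_convex_hull)
    fix e :: real assume e: "e > 0"
    \<comment> \<open>Since \<open>a f\<close> is isometric, it carries the orbit piece over
      \<open>V\<close> into the \<open>e\<close>-ball about \<open>a f x0\<close>; finitely many
      such balls cover the orbit.\<close>
    define V where "V = {g. dist (a g x0) x0 < e}"
    have "open V" unfolding V_def by (intro open_Collect_less continuous_intros cont)
    moreover have "0 \<in> V" using e x0 by (simp add: V_def a_zero)
    ultimately have "0 \<in> interior V" by (simp add: interior_open)
    then obtain F where F: "finite F" "F + V = UNIV"
      using G unfolding precompact_group_def by blast
    have "S \<subseteq> (\<Union>y \<in> (\<lambda>f. a f x0) ` F. ball y e)"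
    proof
      fix s assume "s \<in> S"
      then obtain g where s: "s = a g x0" by (auto simp: S_def)
      have "g \<in> F + V" by (simp add: F(2))
      then obtain f v where fv: "f \<in> F" "v \<in> V" "g = f + v" by (rule set_plus_elim)
      have "dist (a f x0) s < e"
        using fv(2) iso[OF x0 a_E[OF x0], of f v] by (simp add: s fv(3) a_add x0 V_def dist_commute)
      then show "s \<in> (\<Union>y \<in> (\<lambda>f. a f x0) ` F. ball y e)" using fv(1) by auto
    qed
    then show "\<exists>F. finite F \<and> S \<subseteq> (\<Union>x \<in> F. ball x e)" using F(1) by blast
  qed
  moreover have "convex K" by (simp add: K_def convex_closure)
  moreover have "K \<noteq> {}" by (simp add: K_def S_def)
  moreover have hullE: "convex hull S \<subseteq> E" using SE E(2) by (simp add: hull_minimal)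
  then have KE: "K \<subseteq> E" unfolding K_def using E(1) by (simp add: closure_minimal)
  moreover have "a g x \<in> K" if x: "x \<in> K" for g x
  proof -
    \<comment> \<open>The set on the right contains the orbit and is convex because
      \<open>a g\<close> is affine, so the hull of the orbit is invariant.\<close>
    have "convex hull S \<subseteq> {x \<in> E. a g x \<in> convex hull S}"
    proof (rule hull_minimal)
      have "a g (a h x0) \<in> S" for h
        using a_add[OF x0, of g h] by (auto simp: S_def intro: range_eqI[of _ _ "g + h"])
      then show "S \<subseteq> {x \<in> E. a g x \<in> convex hull S}"
        using SE by (auto simp: S_def intro: hull_inc)
      show "convex {x \<in> E. a g x \<in> convex hull S}"
        using E(2) convex_convex_hull[of S]
        by (auto simp: convex_def affine)
    qed
    moreover have "continuous_on E (a g)"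
      unfolding continuous_on_iff using iso by auto
    then have "continuous_on (closure (convex hull S)) (a g)"
      using KE by (auto simp: K_def elim: continuous_on_subset)
    ultimately have "a g ` closure (convex hull S) \<subseteq> closure (convex hull S)"
      using closure_subset[of "convex hull S"] by (intro image_closure_subset) auto
    then show ?thesis using x by (auto simp: K_def)
  qed
  ultimately have "\<exists>x \<in> K. \<forall>g. a g x = x"
    using iso a_zero a_add by (intro isometric_action_fixed_point) (auto simp: subset_iff)
  then show ?thesis using KE by blast
qed

theorem corollary6p2:
  fixes U :: "'u metric" and i :: "'u \<Rightarrow> 'e::banach" and E :: "'e set"
  assumes group: "separable_space (euclidean :: 'g::{topological_group_add, t2_space} topology) \<or>
                  omega_bounded_group TYPE('g)"
    and holmes: "holmes_space U i E"
  shows "precompact_group TYPE('g) \<longleftrightarrow>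
         (\<forall>a :: 'g \<Rightarrow> 'e \<Rightarrow> 'e. continuous_affine_isometric_action E a \<longrightarrow>
            (\<exists>x \<in> E. \<forall>g. a g x = x))"
proof
  assume G: "precompact_group TYPE('g)"
  have E: "E = closure (span (i ` mspace U))" using holmes by (simp add: holmes_space_def)
  have "closed E" "convex E"
    by (simp_all add: E convex_closure subspace_imp_convex)
  moreover have "0 \<in> E"
    unfolding E by (rule closure_subset[THEN subsetD, OF span_zero])
  ultimately show "\<forall>a :: 'g \<Rightarrow> 'e \<Rightarrow> 'e. continuous_affine_isometric_action E a \<longrightarrow> (\<exists>x \<in> E. \<forall>g. a g x = x)"
    using precompact_group_fixed_point[OF G] by blast
next
  assume fixed: "\<forall>a :: 'g \<Rightarrow> 'e \<Rightarrow> 'e. continuous_affine_isometric_action E a \<longrightarrow> (\<exists>x \<in> E. \<forall>g. a g x = x)"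
  have omega: "omega_bounded_group TYPE('g)"
    using group separable_imp_omega_bounded_group by blast
  show "precompact_group TYPE('g)"
    unfolding precompact_group_def
  proof (intro allI impI, rule ccontr)
    fix V :: "'g set" assume "0 \<in> interior V" "\<nexists>F. finite F \<and> F + V = UNIV"
    from fixed_point_free_action_exists[OF omega holmes this] show False
      using fixed by blast
  qed
qed

end
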